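(* For random variables $U,V\sim\mathcal U(0,1)$ on a common probability space and $m=\mathbb E|U-V|$, let $V_{\min}(m)$ be as defined in the context and define $$V_{\max}(m)=\frac{1-(1-2m)^{3/2}}{3}-m^2.$$ Then $$V_{\min}(m)\le\operatorname{Var}(|U-V|)\le V_{\max}(m).$$ The lower bound is attained for $(U,V)\sim C_x$ with $x=1-3m$, and the upper bound is attained for $(U,V)\sim B_x$ with $x=1-3m$, where the copulas $C_x$ and $B_x$ are constructed in the context.
   Context: A bivariate copula is a bivariate distribution function $C$ on $[0,1]^2$ with uniform margins; $(U,V)\sim C$ means that $(U,V)$ has joint distribution function $C$. $\mathcal U(0,1)$ is the uniform distribution on $[0,1]$; $\mathbb E|U-V|\in[0,\tfrac12]$ whenever $U,V\sim\mathcal U(0,1)$. Definition of $V_{\min}$: $V_{\min}(0)=0$; for $m\in(0,\tfrac12]$ choose the integer $N\ge1$ with $m\in(\tfrac1{2N+2},\tfrac1{2N}]$, let $\ell\in\{\tfrac1{2N+2},\tfrac1{2N}\}$ be an endpoint nearest to $m$, $\Delta_m=|m-\ell|$, and $V_{\min}(m)=\frac{2\Delta_m^{3/2}}{3\sqrt{N(N+1)}}-\Delta_m^2$. Bertino copulas $B_x$, $x\in[-\tfrac12,1]$: for $a\in[0,\tfrac12]$ let $\delta_a(t)=0$ for $0\le t\le a$, $\delta_a(t)=t-a$ for $a\le t\le1-a$, $\delta_a(t)=2t-1$ for $1-a\le t\le1$. Put $a_x=\tfrac12\bigl(1-\sqrt{(1+2x)/3}\bigr)$ and $$B_x(u,v)=\min\{u,v\}-\min_{\min\{u,v\}\le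 t\le\max\{u,v\}}\bigl(t-\delta_{a_x}(t)\bigr).$$ Construction of $C_x$ for $x\in[-\tfrac12,1)$. Let $\lambda$ be Lebesgue measure on $[0,1]$, $\lambda|_I$ its restriction to an interval $I$, $F_\#\mu$ the pushforward of $\mu$ under $F$, and $S(u,v)=(v,u)$. Let $m=\tfrac{1-x}3$, let $N\ge1$ be the unique integer with $x\in I_N=[1-\tfrac3{2N},1-\tfrac3{2N+2})$, and put $R=\tfrac1{2N+2}$, $L=\tfrac1{2N}$, $d_N=\tfrac1{L-R}=2N(N+1)$, $I_N^L=[1-3L,\,1-\tfrac32(L+R))$, $I_N^R=[1-\tfrac32(L+R),\,1-3R)$. Put $v=\sqrt{2(L-m)/d_N}$ and $\theta=2L-v$ if $x\in I_N^L$; $v=\sqrt{2(m-R)/d_N}$ and $\theta=2R+v$ if $x\in I_N^R$; and $p=1-d_Nv$ in both cases. Let $\alpha_k=1-\tfrac kN$, $\beta_k=\tfrac{k+1}N$, $\ell_L(t)=L-v+\tfrac tN$, $\ell_R(t)=R+\tfrac tN$. Define, for $0\le t\le Nv$ and $0\le s\le pL$ (resp. $0\le s\le pR$), $A_k^L(s)=(k\theta+Nv+s,\;k\theta+Nv+s+L)$, $B_k^L(t)=(k\theta+t,\;k\theta+t+\ell_L(t))$, $C_k^L(t)=(k\theta+t+\ell_L(t),\;(k+1)\theta+t)$, $A_k^R(s)=(k\theta+s,\;k\theta+s+R)$, $B_k^R(t)=(k\theta+pR+t,\;k\theta+pR+t+\ell_R(t))$, $C_k^R(t)=(k\theta+pR+t+\ell_R(t),\;(k+1)\theta+pR+t)$.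 For $x\in I_N^L$ let $$\nu_x=\sum_{k=0}^{N-1}(A_k^L)_\#(\lambda|_{[0,pL]})+\sum_{k=0}^{N-1}\alpha_k(B_k^L)_\#(\lambda|_{[0,Nv]})+\sum_{k=0}^{N-1}\beta_k(C_k^L)_\#(\lambda|_{[0,Nv]}),$$ and for $x\in I_N^R$ let $$\nu_x=\sum_{k=0}^{N}(A_k^R)_\#(\lambda|_{[0,pR]})+\sum_{k=0}^{N-1}\alpha_k(B_k^R)_\#(\lambda|_{[0,Nv]})+\sum_{k=0}^{N-1}\beta_k(C_k^R)_\#(\lambda|_{[0,Nv]}).$$ Set $\pi_x=\nu_x+S_\#\nu_x$ (a probability measure on $[0,1]^2$ with uniform marginals) and $C_x(u,v)=\pi_x([0,u]\times[0,v])$. For $x=1$, $C_1(u,v)=\min\{u,v\}$. *)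

theory Defs
  imports "HOL-Probability.Probability"
begin

definition uniform01 :: "'a measure \<Rightarrow> ('a \<Rightarrow> real) \<Rightarrow> bool" where
  "uniform01 M U \<longleftrightarrow>
     U \<in> borel_measurable M \<and> distr M borel U = uniform_measure lborel {0..1}"

text \<open>
  Copulas are functions on the unit square; as Isabelle functions they are total on the plane,
  and their values outside the unit square are irrelevant.
\<close>

definition copula :: "(real \<Rightarrow> real \<Rightarrow> real) \<Rightarrow> bool" where
  "copula C \<longleftrightarrow>
     (\<exists>P :: (real \<times> real) measure.
        prob_space P \<and> sets P = sets borel \<and> uniform01 P fst \<and> uniform01 P snd \<and>
        (\<forall>u\<in>{0..1}. \<forall>v\<in>{0..1}. C u v = measure P ({0..u} \<times> {0..v})))"

text \<open>
  The relation \<open>(U, V) \<sim> C\<close>.  For a copula \<open>C\<close> the values on the unit square determine the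
  joint law, since \<open>C u 1 = C 1 u = u\<close> there.
\<close>

definition has_joint_df ::
  "'a measure \<Rightarrow> ('a \<Rightarrow> real) \<Rightarrow> ('a \<Rightarrow> real) \<Rightarrow> (real \<Rightarrow> real \<Rightarrow> real) \<Rightarrow> bool" where
  "has_joint_df M U V C \<longleftrightarrow>
     U \<in> borel_measurable M \<and> V \<in> borel_measurable M \<and>
     (\<forall>u\<in>{0..1}. \<forall>v\<in>{0..1}. measure M {\<omega> \<in> space M. U \<omega> \<le> u \<and> V \<omega> \<le> v} = C u v)"

text \<open>
  At the midpoint of an interval both endpoints are nearest; the distance \<open>\<Delta>\<close> does not depend on
  which of them \<open>arg_min_on\<close> selects.  Only arguments in \<open>[0, 1/2]\<close> are meaningful.
\<close>

definition V_min :: "real \<Rightarrow> real" where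
  "V_min m =
     (if m = 0 then 0
      else let N = real (THE N::nat. 1 \<le> N \<and> m \<in> {1 / (2 * real N + 2) <.. 1 / (2 * real N)});
               l = arg_min_on (\<lambda>l. \<bar>m - l\<bar>) {1 / (2 * N + 2), 1 / (2 * N)};
               \<Delta> = \<bar>m - l\<bar>
           in 2 * \<Delta> powr (3/2) / (3 * sqrt (N * (N + 1))) - \<Delta>\<^sup>2)"

definition V_max :: "real \<Rightarrow> real" where
  "V_max m = (1 - (1 - 2 * m) powr (3/2)) / 3 - m\<^sup>2"

definition bertino_diag :: "real \<Rightarrow> real \<Rightarrow> real" where
  "bertino_diag a t = (if t \<le> a then 0 else if t \<le> 1 - a then t - a else 2 * t - 1)"

definition bertino_a :: "real \<Rightarrow> real" where
  "bertino_a x = (1 - sqrt ((1 + 2 * x) / 3)) / 2"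

text \<open>The infimum is a minimum, as \<open>t - bertino_diag a t\<close> is continuous in \<open>t\<close> for \<open>a \<in> [0, 1/2]\<close>.\<close>

definition bertino_copula :: "real \<Rightarrow> real \<Rightarrow> real \<Rightarrow> real" where
  "bertino_copula x u v =
     min u v - (INF t\<in>{min u v .. max u v}. t - bertino_diag (bertino_a x) t)"

definition measure_sum :: "'i set \<Rightarrow> ('i \<Rightarrow> 'a::topological_space measure) \<Rightarrow> 'a measure" where
  "measure_sum I \<mu> = measure_of UNIV (sets borel) (\<lambda>E. \<Sum>i\<in>I. emeasure (\<mu> i) E)"

definition measure_add ::
  "'a::topological_space measure \<Rightarrow> 'a measure \<Rightarrow> 'a measure" where
  "measure_add \<mu> \<nu> = measure_of UNIV (sets borel) (\<lambda>E. emeasure \<mu> E + emeasure \<nu> E)"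

lemma emeasure_measure_sum:
  fixes \<mu> :: "'i \<Rightarrow> 'a::topological_space measure"
  assumes "\<And>i. i \<in> I \<Longrightarrow> sets (\<mu> i) = sets borel" and "E \<in> sets borel"
  shows "emeasure (measure_sum I \<mu>) E = (\<Sum>i\<in>I. emeasure (\<mu> i) E)"
  unfolding measure_sum_def
proof (rule emeasure_measure_of_sigma)
  show "sigma_algebra UNIV (sets (borel :: 'a measure))"
    using sets.sigma_algebra_axioms[of "borel :: 'a measure"] by simp
  show "positive (sets borel) (\<lambda>E. \<Sum>i\<in>I. emeasure (\<mu> i) E)"
    by (simp add: positive_def)
  show "countably_additive (sets borel) (\<lambda>E. \<Sum>i\<in>I. emeasure (\<mu> i) E)"
    unfolding countably_additive_def
  proof (intro allI impI)
    fix A :: "nat \<Rightarrow> 'a set"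
    assume A: "range A \<subseteq> sets borel" "disjoint_family A"
    have "(\<Sum>n. \<Sum>i\<in>I. emeasure (\<mu> i) (A n)) = (\<Sum>i\<in>I. \<Sum>n. emeasure (\<mu> i) (A n))"
      by (rule suminf_sum) auto
    also have "\<dots> = (\<Sum>i\<in>I. emeasure (\<mu> i) (\<Union>n. A n))"
      using A assms(1) by (intro sum.cong refl suminf_emeasure) auto
    finally show "(\<Sum>n. \<Sum>i\<in>I. emeasure (\<mu> i) (A n)) = (\<Sum>i\<in>I. emeasure (\<mu> i) (\<Union>n. A n))" .
  qed
qed (use assms in auto)

lemma emeasure_measure_add:
  assumes "sets \<mu> = sets borel" "sets \<nu> = sets borel" "E \<in> sets borel"
  shows "emeasure (measure_add \<mu> \<nu>) E = emeasure \<mu> E + emeasure \<nu> E"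
proof -
  have "measure_add \<mu> \<nu> = measure_sum UNIV (\<lambda>b. if b then \<mu> else \<nu>)"
    by (simp add: measure_add_def measure_sum_def UNIV_bool add.commute)
  then show ?thesis
    using assms by (simp add: emeasure_measure_sum UNIV_bool add.commute)
qed

lemma sets_measure_sum [simp, measurable_cong]: "sets (measure_sum I \<mu>) = sets borel"
  unfolding measure_sum_def
  by (metis sets.sets_measure_of_eq space_borel)

lemma sets_measure_add [simp, measurable_cong]: "sets (measure_add \<mu> \<nu>) = sets borel"
  unfolding measure_add_def
  by (metis sets.sets_measure_of_eq space_borel)

text \<open>
  Throughout, \<open>x \<in> [-1/2, 1)\<close>.  The suffixes \<open>L\<close> and \<open>R\<close> refer to \<open>x\<close> lying in the left or right
  half of its interval \<open>I\<^sub>N\<close>.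
\<close>

definition cop_N :: "real \<Rightarrow> nat" where
  "cop_N x = (THE N::nat. 1 \<le> N \<and> x \<in> {1 - 3 / (2 * real N) ..< 1 - 3 / (2 * real N + 2)})"

definition cop_R :: "real \<Rightarrow> real" where
  "cop_R x = 1 / (2 * real (cop_N x) + 2)"

definition cop_L :: "real \<Rightarrow> real" where
  "cop_L x = 1 / (2 * real (cop_N x))"

definition cop_d :: "real \<Rightarrow> real" where
  "cop_d x = 1 / (cop_L x - cop_R x)"

definition left_half :: "real \<Rightarrow> bool" where
  "left_half x \<longleftrightarrow> x \<in> {1 - 3 * cop_L x ..< 1 - 3 / 2 * (cop_L x + cop_R x)}"

definition cop_v :: "real \<Rightarrow> real" where
  "cop_v x =
     (let m = (1 - x) / 3
      in if left_half x then sqrt (2 * (cop_L x - m) / cop_d x)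
         else sqrt (2 * (m - cop_R x) / cop_d x))"

definition cop_theta :: "real \<Rightarrow> real" where
  "cop_theta x = (if left_half x then 2 * cop_L x - cop_v x else 2 * cop_R x + cop_v x)"

definition cop_p :: "real \<Rightarrow> real" where
  "cop_p x = 1 - cop_d x * cop_v x"

definition cop_alpha :: "real \<Rightarrow> nat \<Rightarrow> real" where
  "cop_alpha x k = 1 - real k / real (cop_N x)"

definition cop_beta :: "real \<Rightarrow> nat \<Rightarrow> real" where
  "cop_beta x k = (real k + 1) / real (cop_N x)"

definition ell_L :: "real \<Rightarrow> real \<Rightarrow> real" where
  "ell_L x t = cop_L x - cop_v x + t / real (cop_N x)"

definition ell_R :: "real \<Rightarrow> real \<Rightarrow> real" where
  "ell_R x t = cop_R x + t / real (cop_N x)"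

definition A_L :: "real \<Rightarrow> nat \<Rightarrow> real \<Rightarrow> real \<times> real" where
  "A_L x k s = (real k * cop_theta x + real (cop_N x) * cop_v x + s,
                real k * cop_theta x + real (cop_N x) * cop_v x + s + cop_L x)"

definition B_L :: "real \<Rightarrow> nat \<Rightarrow> real \<Rightarrow> real \<times> real" where
  "B_L x k t = (real k * cop_theta x + t,
                real k * cop_theta x + t + ell_L x t)"

definition C_L :: "real \<Rightarrow> nat \<Rightarrow> real \<Rightarrow> real \<times> real" where
  "C_L x k t = (real k * cop_theta x + t + ell_L x t,
                (real k + 1) * cop_theta x + t)"

definition A_R :: "real \<Rightarrow> nat \<Rightarrow> real \<Rightarrow> real \<times> real" where
  "A_R x k s = (real k * cop_theta x + s,
                real k * cop_theta x + s + cop_R x)"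

definition B_R :: "real \<Rightarrow> nat \<Rightarrow> real \<Rightarrow> real \<times> real" where
  "B_R x k t = (real k * cop_theta x + cop_p x * cop_R x + t,
                real k * cop_theta x + cop_p x * cop_R x + t + ell_R x t)"

definition C_R :: "real \<Rightarrow> nat \<Rightarrow> real \<Rightarrow> real \<times> real" where
  "C_R x k t = (real k * cop_theta x + cop_p x * cop_R x + t + ell_R x t,
                (real k + 1) * cop_theta x + cop_p x * cop_R x + t)"

text \<open>The measure \<open>c F\<^sub># (\<lambda>|\<^sub>[\<^sub>0\<^sub>,\<^sub>a\<^sub>])\<close>; all lengths \<open>a\<close> used below are at most 1.\<close>

definition segment_measure :: "real \<Rightarrow> (real \<Rightarrow> real \<times> real) \<Rightarrow> real \<Rightarrow> (real \<times> real) measure" where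
  "segment_measure c F a =
     scale_measure (ennreal c) (distr (restrict_space lborel {0..a}) borel F)"

definition cop_nu :: "real \<Rightarrow> (real \<times> real) measure" where
  "cop_nu x =
     (let N = cop_N x; v = cop_v x; p = cop_p x
      in if left_half x then
           measure_add
             (measure_sum {0..N-1} (\<lambda>k. segment_measure 1 (A_L x k) (p * cop_L x)))
             (measure_add
               (measure_sum {0..N-1} (\<lambda>k. segment_measure (cop_alpha x k) (B_L x k) (real N * v)))
               (measure_sum {0..N-1} (\<lambda>k. segment_measure (cop_beta x k) (C_L x k) (real N * v))))
         else
           measure_add
             (measure_sum {0..N} (\<lambda>k. segment_measure 1 (A_R x k) (p * cop_R x)))
             (measure_add
               (measure_sum {0..N-1} (\<lambda>k. segment_measure (cop_alpha x k) (B_R x k) (real N * v)))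
               (measure_sum {0..N-1} (\<lambda>k. segment_measure (cop_beta x k) (C_R x k) (real N * v)))))"

definition cop_pi :: "real \<Rightarrow> (real \<times> real) measure" where
  "cop_pi x = measure_add (cop_nu x) (distr (cop_nu x) borel prod.swap)"

definition min_copula :: "real \<Rightarrow> real \<Rightarrow> real \<Rightarrow> real" where
  "min_copula x u v = (if x = 1 then min u v else measure (cop_pi x) ({0..u} \<times> {0..v}))"

end

theory Submission
  imports Defs
begin

text \<open>
  Write \<open>D = \<bar>U - V\<bar>\<close>.  Fixing the mean of \<open>D\<close>, the variance is controlled by the second moment, and an
  extremal second moment at fixed mean is an optimal transport problem between two copies of the uniform
  law.  Both bounds are proved by exhibiting a dual solution: a function \<open>f\<close> such that \<open>f x + f y\<close> lies on
  the correct side of a quadratic function of \<open>\<bar>x - y\<bar>\<close>.  Integrating gives a bound that depends only on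
  the marginals, and a coupling attains it as soon as equality holds on its support.

  Upper bound.  With \<open>q = \<surd>(1 - 2m)\<close> and \<open>\<phi> d = max 0 (d\<^sup>2 - q d)\<close>, which is convex and increasing on
  \<open>d \<ge> 0\<close>, the triangle inequality through the midpoint \<open>1/2\<close> gives
  \<open>D\<^sup>2 - q D \<le> (\<phi> \<bar>2U - 1\<bar> + \<phi> \<bar>2V - 1\<bar>) / 2\<close>, and \<open>\<bar>2U - 1\<bar>\<close> is uniform
  (\<open>distance_second_moment_le\<close>).  The Bertino copula is the law of \<open>(x, T x)\<close> where \<open>T\<close> reflects the two
  outer intervals at \<open>1/2\<close> and fixes the middle one (\<open>bertino_attains\<close>).

  Lower bound.  The cost is \<open>(D - \<kappa>)\<^sup>2\<close>, where \<open>2\<kappa>\<close> is the translation length \<open>\<theta>\<close> of the construction.  The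
  dual solution is \<open>2\<kappa>\<close>-periodic: it depends only on the distance \<open>r\<close> to a lattice \<open>c + 2\<kappa>\<int>\<close>.  On
  the circle of length \<open>2\<kappa>\<close> the distances \<open>r, s\<close> of two points to \<open>c\<close> satisfy
  \<open>\<bar>\<kappa> - r - s\<bar> \<le> \<bar>\<bar>x - y\<bar> - \<kappa>\<bar>\<close> (\<open>phase_dist_pair\<close>), so that a one-dimensional inequality for a piecewise
  quadratic function of \<open>r\<close> suffices (\<open>potential_sum_le\<close>).  Modulo \<open>2\<kappa>\<close>, the unit interval covers an arc
  \<open>N + 1\<close> times and the rest \<open>N\<close> times; this mismatch between a point and its antipode is what forces the
  curvatures \<open>-2/N\<close> and \<open>2/(N + 1)\<close> of the potential.

  Both halves of the construction of \<open>C\<^sub>x\<close> are instances of one family of singular laws, described by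
  \<open>chain_geometry\<close> and \<open>chain_integral\<close>.  For this family the marginals are uniform because the projected
  segments tile \<open>[0, 1]\<close> (\<open>chain_integral_marginal\<close>), the duality inequality is an equality on every segment
  (\<open>chain_integral_tight\<close>), and the moments of \<open>D\<close> are explicit (\<open>chain_integral_distance_power\<close>).  Optimality is
  then \<open>chain_law_minimal_second_moment\<close>; no integral of the potential has to be computed.

  Attainment is asserted for every pair with the given joint distribution function, so it is also needed
  that the values of a copula on the unit square determine the joint law (\<open>joint_law_unique\<close>).
\<close>

section \<open>Integrals against sums of segment measures\<close>

lemma borel_measurable_projections [measurable]:
  "fst \<in> borel_measurable (borel :: (real \<times> real) measure)"
  "snd \<in> borel_measurable (borel :: (real \<times> real) measure)"
  by (intro borel_measurable_continuous_onI continuous_intros)+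

lemma nn_integral_measure_sum:
  fixes \<mu> :: "'i \<Rightarrow> 'a::topological_space measure"
  assumes fin: "finite I" and sets: "\<And>i. i \<in> I \<Longrightarrow> sets (\<mu> i) = sets borel"
    and g: "g \<in> borel_measurable borel"
  shows "(\<integral>\<^sup>+ z. g z \<partial>measure_sum I \<mu>) = (\<Sum>i\<in>I. \<integral>\<^sup>+ z. g z \<partial>\<mu> i)"
  using g
proof (induction rule: borel_measurable_induct)
  case (cong f g)
  have "(\<integral>\<^sup>+ z. f z \<partial>measure_sum I \<mu>) = (\<integral>\<^sup>+ z. g z \<partial>measure_sum I \<mu>)"
    using cong(3) by (simp add: space_borel)
  moreover have "(\<integral>\<^sup>+ z. f z \<partial>\<mu> i) = (\<integral>\<^sup>+ z. g z \<partial>\<mu> i)" if "i \<in> I" for i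
    using cong(3) by (simp add: space_borel)
  ultimately show ?case using cong by simp
next
  case (set A)
  then show ?case using sets by (simp add: emeasure_measure_sum)
next
  case (mult u c)
  have [measurable]: "u \<in> borel_measurable (\<mu> i)" if "i \<in> I" for i
    using mult measurable_cong_sets[OF sets[OF that] refl] by auto
  have [measurable]: "u \<in> borel_measurable (measure_sum I \<mu>)"
    using mult measurable_cong_sets[OF sets_measure_sum refl] by auto
  show ?case using mult by (simp add: nn_integral_cmult sum_distrib_left)
next
  case (add u v)
  have 1: "u \<in> borel_measurable (\<mu> i)" "v \<in> borel_measurable (\<mu> i)" if "i \<in> I" for i
    unfolding measurable_cong_sets[OF sets[OF that] refl] by (rule add)+
  have 2: "u \<in> borel_measurable (measure_sum I \<mu>)" "v \<in> borel_measurable (measure_sum I \<mu>)"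
    using add measurable_cong_sets[OF sets_measure_sum refl, of I \<mu> borel] by simp_all
  show ?case using add 1 2 by (simp add: nn_integral_add sum.distrib)
next
  case (seq U)
  have 1: "U n \<in> borel_measurable (\<mu> i)" if "i \<in> I" for i n
    unfolding measurable_cong_sets[OF sets[OF that] refl] by (rule seq)
  have 2: "U n \<in> borel_measurable (measure_sum I \<mu>)" for n
    using seq measurable_cong_sets[OF sets_measure_sum refl] by auto
  have inc: "incseq (\<lambda>n. \<integral>\<^sup>+ z. U n z \<partial>M)" for M :: "'a measure"
    using seq(3) by (auto simp: incseq_def le_fun_def intro!: nn_integral_mono)
  have "(\<integral>\<^sup>+ z. (SUP n. U n) z \<partial>measure_sum I \<mu>) = (SUP n. \<integral>\<^sup>+ z. U n z \<partial>measure_sum I \<mu>)"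
    using seq(3) 2 by (simp add: nn_integral_monotone_convergence_SUP image_comp)
  also have "\<dots> = (SUP n. \<Sum>i\<in>I. \<integral>\<^sup>+ z. U n z \<partial>\<mu> i)"
    using seq by simp
  also have "\<dots> = (\<Sum>i\<in>I. SUP n. \<integral>\<^sup>+ z. U n z \<partial>\<mu> i)"
    by (rule ennreal_SUP_sum) (rule inc)
  also have "\<dots> = (\<Sum>i\<in>I. \<integral>\<^sup>+ z. (SUP n. U n) z \<partial>\<mu> i)"
    using seq(3) 1 by (simp add: nn_integral_monotone_convergence_SUP image_comp)
  finally show ?case .
qed

lemma nn_integral_measure_add:
  assumes "sets \<mu> = sets borel" "sets \<nu> = sets borel" "g \<in> borel_measurable borel"
  shows "(\<integral>\<^sup>+ z. g z \<partial>measure_add \<mu> \<nu>) = (\<integral>\<^sup>+ z. g z \<partial>\<mu>) + (\<integral>\<^sup>+ z. g z \<partial>\<nu>)"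
proof -
  have "measure_add \<mu> \<nu> = measure_sum UNIV (\<lambda>b. if b then \<mu> else \<nu>)"
    by (simp add: measure_add_def measure_sum_def UNIV_bool add.commute)
  then show ?thesis
    using assms by (simp add: nn_integral_measure_sum UNIV_bool add.commute)
qed

lemma sets_segment_measure [simp, measurable_cong]: "sets (segment_measure c F a) = sets borel"
  by (simp add: segment_measure_def)

lemma nn_integral_segment_measure:
  assumes [measurable]: "F \<in> borel_measurable borel" "g \<in> borel_measurable borel"
  shows "(\<integral>\<^sup>+ z. g z \<partial>segment_measure c F a)
    = ennreal c * (\<integral>\<^sup>+ t. g (F t) * indicator {0..a} t \<partial>lborel)"
proof -
  have m[measurable]: "F \<in> measurable (restrict_space lborel {0..a}) borel"
    by (rule measurable_restrict_space1) simp
  show ?thesis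
    by (simp add: segment_measure_def nn_integral_scale_measure nn_integral_distr
        nn_integral_restrict_space)
qed

lemma nn_integral_interval_split:
  fixes h :: "real \<Rightarrow> ennreal"
  assumes [measurable]: "h \<in> borel_measurable borel" and "a \<le> b" "b \<le> c"
  shows "(\<integral>\<^sup>+ x. h x * indicator {a..b} x \<partial>lborel) + (\<integral>\<^sup>+ x. h x * indicator {b..c} x \<partial>lborel)
    = (\<integral>\<^sup>+ x. h x * indicator {a..c} x \<partial>lborel)"
proof -
  have "(\<integral>\<^sup>+ x. h x * indicator {a..b} x \<partial>lborel) + (\<integral>\<^sup>+ x. h x * indicator {b..c} x \<partial>lborel)
     = (\<integral>\<^sup>+ x. h x * indicator {a..b} x + h x * indicator {b..c} x \<partial>lborel)"
    by (rule nn_integral_add[symmetric]) auto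
  also have "\<dots> = (\<integral>\<^sup>+ x. h x * indicator {a..c} x \<partial>lborel)"
    using AE_lborel_singleton[of b] assms(2,3)
    by (intro nn_integral_cong_AE) (auto elim!: eventually_mono split: split_indicator)
  finally show ?thesis .
qed

lemma nn_integral_interval_affine:
  fixes h :: "real \<Rightarrow> ennreal"
  assumes [measurable]: "h \<in> borel_measurable borel" and "0 < \<beta>"
  shows "ennreal \<beta> * (\<integral>\<^sup>+ t. h (\<alpha> + \<beta> * t) * indicator {0..c} t \<partial>lborel)
    = (\<integral>\<^sup>+ x. h x * indicator {\<alpha>..\<alpha> + \<beta> * c} x \<partial>lborel)"
proof -
  have "(\<integral>\<^sup>+ x. h x * indicator {\<alpha>..\<alpha> + \<beta> * c} x \<partial>lborel)
    = ennreal \<bar>\<beta>\<bar> * (\<integral>\<^sup>+ t. h (\<alpha> + \<beta> * t) * indicator {\<alpha>..\<alpha> + \<beta> * c} (\<alpha> + \<beta> * t) \<partial>lborel)"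
    using assms(2) by (intro nn_integral_real_affine) auto
  also have "(\<lambda>t. h (\<alpha> + \<beta> * t) * indicator {\<alpha>..\<alpha> + \<beta> * c} (\<alpha> + \<beta> * t))
    = (\<lambda>t. h (\<alpha> + \<beta> * t) * indicator {0..c} t)"
    using assms(2) by (auto simp: fun_eq_iff indicator_def zero_le_mult_iff)
  finally show ?thesis using assms(2) by simp
qed

lemma nn_integral_interval_shift:
  fixes h :: "real \<Rightarrow> ennreal"
  assumes "h \<in> borel_measurable borel"
  shows "(\<integral>\<^sup>+ t. h (\<alpha> + t) * indicator {0..c} t \<partial>lborel)
    = (\<integral>\<^sup>+ x. h x * indicator {\<alpha>..\<alpha> + c} x \<partial>lborel)"
  using nn_integral_interval_affine[OF assms, of 1 \<alpha> c] by simp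

lemma nn_integral_interval_reflect:
  fixes h :: "real \<Rightarrow> ennreal"
  assumes [measurable]: "h \<in> borel_measurable borel"
  shows "(\<integral>\<^sup>+ t. h (1 - t) * indicator {a..b} t \<partial>lborel)
    = (\<integral>\<^sup>+ x. h x * indicator {1 - b..1 - a} x \<partial>lborel)"
proof -
  have "(\<integral>\<^sup>+ x. h x * indicator {1 - b..1 - a} x \<partial>lborel)
    = ennreal \<bar>-1\<bar> * (\<integral>\<^sup>+ t. h (1 + (-1) * t) * indicator {1 - b..1 - a} (1 + (-1) * t) \<partial>lborel)"
    by (intro nn_integral_real_affine) auto
  also have "(\<lambda>t. h (1 + (-1) * t) * indicator {1 - b..1 - a} (1 + (-1) * t))
    = (\<lambda>t. h (1 - t) * indicator {a..b} t)"
    by (auto simp: fun_eq_iff indicator_def)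
  finally show ?thesis by simp
qed

lemma nn_integral_uniform_unit:
  fixes h :: "real \<Rightarrow> ennreal"
  assumes [measurable]: "h \<in> borel_measurable borel"
  shows "(\<integral>\<^sup>+ x. h x \<partial>uniform_measure lborel {0..1}) = (\<integral>\<^sup>+ x. h x * indicator {0..1} x \<partial>lborel)"
  by (subst nn_integral_uniform_measure) (auto simp: divide_ennreal_def)


section \<open>Uniform random variables\<close>

lemma uniform01I:
  assumes U [measurable]: "U \<in> borel_measurable M"
    and eq: "\<And>h :: real \<Rightarrow> ennreal. h \<in> borel_measurable borel \<Longrightarrow>
      (\<integral>\<^sup>+ \<omega>. h (U \<omega>) \<partial>M) = (\<integral>\<^sup>+ x. h x * indicator {0..1} x \<partial>lborel)"
  shows "uniform01 M U"
  unfolding uniform01_def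
proof (intro conjI U measure_eqI)
  fix E assume "E \<in> sets (distr M borel U)"
  then have [measurable]: "E \<in> sets borel" by simp
  have "emeasure (distr M borel U) E = (\<integral>\<^sup>+ \<omega>. indicator E (U \<omega>) \<partial>M)"
    by (subst nn_integral_distr[symmetric, where M'=borel]) auto
  also have "\<dots> = (\<integral>\<^sup>+ x. indicator E x * indicator {0..1} x \<partial>lborel)"
    by (rule eq) simp
  also have "\<dots> = emeasure (uniform_measure lborel {0..1}) E"
    by (subst nn_integral_uniform_unit[symmetric]) auto
  finally show "emeasure (distr M borel U) E = emeasure (uniform_measure lborel {0..1}) E" .
qed auto

lemma uniform01_AE:
  assumes "uniform01 M U" shows "AE \<omega> in M. U \<omega> \<in> {0..1}"
proof -
  have [measurable]: "U \<in> borel_measurable M" using assms by (simp add: uniform01_def)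
  have "distr M borel U = uniform_measure lborel {0..1}"
    using assms by (simp add: uniform01_def)
  moreover have "AE x in uniform_measure lborel {0..1::real}. x \<in> {0..1}"
    by (rule AE_uniform_measureI) auto
  ultimately have "AE x in distr M borel U. x \<in> {0..1}"
    by (simp only:)
  then show ?thesis by (subst (asm) AE_distr_iff) auto
qed

lemma uniform01_expectation:
  fixes f :: "real \<Rightarrow> real"
  assumes "uniform01 M U" "f \<in> borel_measurable borel"
  shows "(\<integral>\<omega>. f (U \<omega>) \<partial>M) = (\<integral>x. f x \<partial>uniform_measure lborel {0..1})"
proof -
  have "U \<in> borel_measurable M" using assms by (simp add: uniform01_def)
  then have "(\<integral>\<omega>. f (U \<omega>) \<partial>M) = (\<integral>x. f x \<partial>distr M borel U)"
    using assms by (subst integral_distr) auto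
  then show ?thesis using assms by (simp add: uniform01_def)
qed

lemma prob_space_uniform01:
  assumes "uniform01 M U" shows "prob_space M"
proof -
  have U: "U \<in> borel_measurable M" using assms by (simp add: uniform01_def)
  have "prob_space (uniform_measure lborel {0..1::real})"
    by (rule prob_space_uniform_measure) auto
  then have "prob_space (distr M borel U)" using assms by (simp add: uniform01_def)
  then show ?thesis by (rule prob_space_distrD[OF U])
qed


section \<open>The joint law determined by a copula\<close>

text \<open>
  The uniform marginals force the mass of the axes and of the complement of the unit square to vanish, so
  the distribution function on the whole plane is determined by its values on the square; the lower left
  quadrants form an intersection-stable generator of the Borel sets.
\<close>

lemma joint_law_unique:
  assumes M: "prob_space M" and df: "has_joint_df M U V C"
    and P: "prob_space P" "sets P = sets borel" "uniform01 P fst" "uniform01 P snd"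
    and C: "\<And>u v. u \<in> {0..1} \<Longrightarrow> v \<in> {0..1} \<Longrightarrow> C u v = measure P ({0..u} \<times> {0..v})"
  shows "distr M borel (\<lambda>\<omega>. (U \<omega>, V \<omega>)) = P"
proof -
  interpret M: prob_space M by fact
  interpret P: prob_space P by fact
  have [measurable]: "U \<in> borel_measurable M" "V \<in> borel_measurable M"
    using df by (auto simp: has_joint_df_def)
  have [measurable_cong]: "sets P = sets borel" by fact
  have P01: "AE z in P. fst z \<in> {0..1} \<and> snd z \<in> {0..1}"
    using uniform01_AE[OF P(3)] uniform01_AE[OF P(4)] by eventually_elim auto
  let ?Q = "distr M borel (\<lambda>\<omega>. (U \<omega>, V \<omega>))"
  interpret Q: prob_space ?Q by (rule M.prob_space_distr) simp
  define A where "A u v = ({..u} \<times> {..v} :: (real \<times> real) set)" for u v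
  have A_borel [measurable]: "A u v \<in> sets borel" for u v
    unfolding A_def by (intro borel_closed closed_Times closed_atMost)
  have proj [measurable]: "fst \<in> borel_measurable P" "snd \<in> borel_measurable P"
    using P(3,4) by (auto simp: uniform01_def)
  have spP: "space P = UNIV" using sets_eq_imp_space_eq[OF P(2)] by simp
  have Pbox: "measure P ({0..u} \<times> {0..v}) = measure P (A u v)" for u v
  proof (rule P.finite_measure_eq_AE)
    show "AE z in P. z \<in> {0..u} \<times> {0..v} \<longleftrightarrow> z \<in> A u v"
      using P01 by eventually_elim (auto simp: A_def mem_Times_iff)
  qed (use P(2) in \<open>auto intro!: borel_closed closed_Times\<close>)
  have sq: "measure ?Q (A u v) = measure P (A u v)" if "u \<in> {0..1}" "v \<in> {0..1}" for u v
  proof -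
    have "measure ?Q (A u v) = measure M {\<omega> \<in> space M. U \<omega> \<le> u \<and> V \<omega> \<le> v}"
      by (subst measure_distr[OF _ A_borel]) (auto simp: A_def intro!: arg_cong[where f="measure M"])
    also have "\<dots> = C u v" using df that by (simp add: has_joint_df_def)
    also have "\<dots> = measure P (A u v)" using C[OF that] Pbox by simp
    finally show ?thesis .
  qed
  have P1: "measure P (A 1 1) = 1"
  proof (subst P.prob_eq_1)
    show "AE z in P. z \<in> A 1 1"
      using P01 by eventually_elim (auto simp: A_def mem_Times_iff)
  qed (simp add: P(2))
  have "measure P (A 0 1) = measure P ((fst -` {..0}) \<inter> space P)"
  proof (rule P.finite_measure_eq_AE)
    show "AE z in P. z \<in> A 0 1 \<longleftrightarrow> z \<in> fst -` {..0} \<inter> space P"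
      using P01 by eventually_elim (auto simp: A_def spP mem_Times_iff)
  qed (use measurable_sets[of fst P borel "{..0::real}"] proj A_borel in \<open>auto simp: P(2)\<close>)
  also have "\<dots> = measure (distr P borel fst) {..0}"
    by (subst measure_distr) (use proj in auto)
  also have "\<dots> = 0"
    using P(3) by (simp add: uniform01_def measure_uniform_measure)
  finally have P0: "measure P (A 0 1) = 0" .
  have "measure P (A 1 0) = measure P ((snd -` {..0}) \<inter> space P)"
  proof (rule P.finite_measure_eq_AE)
    show "AE z in P. z \<in> A 1 0 \<longleftrightarrow> z \<in> snd -` {..0} \<inter> space P"
      using P01 by eventually_elim (auto simp: A_def spP mem_Times_iff)
  qed (use measurable_sets[of snd P borel "{..0::real}"] proj A_borel in \<open>auto simp: P(2)\<close>)
  also have "\<dots> = measure (distr P borel snd) {..0}"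
    by (subst measure_distr) (use proj in auto)
  also have "\<dots> = 0"
    using P(4) by (simp add: uniform01_def measure_uniform_measure)
  finally have P0': "measure P (A 1 0) = 0" .
  have spQ: "space ?Q = UNIV" by simp
  have supp: "AE z in R. fst z \<in> {0<..1} \<and> snd z \<in> {0<..1}"
    if "prob_space R" "sets R = sets borel" "measure R (A 1 1) = 1" "measure R (A 0 1) = 0"
      "measure R (A 1 0) = 0" for R :: "(real \<times> real) measure"
  proof -
    interpret R: prob_space R by fact
    have "AE z in R. z \<in> A 1 1" using that by (subst R.prob_eq_1[symmetric]) auto
    moreover have "AE z in R. z \<notin> A 0 1"
      using that by (subst AE_iff_measurable[where N="A 0 1"])
        (auto simp: R.emeasure_eq_measure sets_eq_imp_space_eq[OF that(2)])
    moreover have "AE z in R. z \<notin> A 1 0"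
      using that by (subst AE_iff_measurable[where N="A 1 0"])
        (auto simp: R.emeasure_eq_measure sets_eq_imp_space_eq[OF that(2)])
    ultimately show ?thesis by eventually_elim (auto simp: A_def)
  qed
  have clamp: "measure R (A u v) = (if u < 0 \<or> v < 0 then 0 else measure R (A (min u 1) (min v 1)))"
    if "prob_space R" "sets R = sets borel" "AE z in R. fst z \<in> {0<..1} \<and> snd z \<in> {0<..1}"
    for R :: "(real \<times> real) measure" and u v
  proof -
    interpret R: prob_space R by fact
    have "measure R (A u v) = measure R (if u < 0 \<or> v < 0 then {} else A (min u 1) (min v 1))"
    proof (rule R.finite_measure_eq_AE)
      show "AE z in R. z \<in> A u v \<longleftrightarrow> z \<in> (if u < 0 \<or> v < 0 then {} else A (min u 1) (min v 1))"
        using that(3) by eventually_elim (auto simp: A_def mem_Times_iff)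
    qed (auto simp: that(2))
    then show ?thesis by simp
  qed
  have all: "measure ?Q (A u v) = measure P (A u v)" for u v
  proof -
    have "AE z in ?Q. fst z \<in> {0<..1} \<and> snd z \<in> {0<..1}"
      using P1 P0 P0' sq[of 1 1] sq[of 0 1] sq[of 1 0]
      by (intro supp Q.prob_space_axioms) auto
    from clamp[OF Q.prob_space_axioms _ this, of u v]
    show ?thesis
      using clamp[OF P(1) P(2) supp[OF P(1,2) P1 P0 P0'], of u v] sq[of "min u 1" "min v 1"] by auto
  qed
  have atM: "{..z} = A (fst z) (snd z)" for z by (auto simp: A_def less_eq_prod_def)
  show ?thesis
  proof (rule measure_eqI_generator_eq[where E="range (\<lambda>z::real \<times> real. {..z})" and \<Omega>=UNIV
        and A="\<lambda>n. {..(real n, real n)}"])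
    show "Int_stable (range (\<lambda>z::real \<times> real. {..z}))"
    proof (clarsimp simp: Int_stable_def)
      fix a b a' b' :: real
      have "{..(a, b)} \<inter> {..(a', b')} = {..(min a a', min b b')}"
        by (auto simp: less_eq_prod_def)
      then show "{..(a, b)} \<inter> {..(a', b')} \<in> range atMost" by simp
    qed
    show "sets ?Q = sigma_sets UNIV (range (\<lambda>z::real \<times> real. {..z}))"
      by (subst sets_distr, subst borel_eq_atMost) simp
    then show "sets P = sigma_sets UNIV (range (\<lambda>z::real \<times> real. {..z}))"
      using P(2) by simp
    show "(\<Union>n. {..(real n, real n)}) = (UNIV :: (real \<times> real) set)"
    proof (auto simp: less_eq_prod_def)
      fix a b :: real
      obtain n where "max a b \<le> real n" using real_arch_simple by blast
      then show "\<exists>n. a \<le> real n \<and> b \<le> real n" by auto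
    qed
    show "emeasure ?Q X = emeasure P X" if "X \<in> range (\<lambda>z::real \<times> real. {..z})" for X
      using that all by (auto simp: atM Q.emeasure_eq_measure P.emeasure_eq_measure)
  qed (auto simp: Q.emeasure_eq_measure)
qed

lemma integrable_bounded_on_square:
  fixes g :: "real \<times> real \<Rightarrow> real"
  assumes U: "uniform01 M U" and V: "uniform01 M V" and [measurable]: "g \<in> borel_measurable borel"
    and B: "\<And>x y. x \<in> {0..1} \<Longrightarrow> y \<in> {0..1} \<Longrightarrow> \<bar>g (x, y)\<bar> \<le> B"
  shows "integrable M (\<lambda>\<omega>. g (U \<omega>, V \<omega>))"
proof -
  interpret prob_space M by (rule prob_space_uniform01[OF U])
  have [measurable]: "U \<in> borel_measurable M" "V \<in> borel_measurable M"
    using U V by (auto simp: uniform01_def)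
  show ?thesis
  proof (rule integrable_const_bound[where B=B])
    show "AE \<omega> in M. norm (g (U \<omega>, V \<omega>)) \<le> B"
      using uniform01_AE[OF U] uniform01_AE[OF V] by eventually_elim (auto intro: B)
  qed measurable
qed

lemma integrable_distance_power:
  assumes "uniform01 M U" "uniform01 M V"
  shows "integrable M (\<lambda>\<omega>. \<bar>U \<omega> - V \<omega>\<bar> ^ j)"
proof -
  have "\<bar>x - y\<bar> ^ j \<le> 1" if "x \<in> {0..1}" "y \<in> {0..1}" for x y :: real
    using that by (intro power_le_one) auto
  then show ?thesis
    using integrable_bounded_on_square[OF assms, of "\<lambda>z. \<bar>fst z - snd z\<bar> ^ j" 1]
    by (simp del: power_abs)
qed

lemma variance_distance:
  assumes "uniform01 M U" "uniform01 M V"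
  shows "prob_space.variance M (\<lambda>\<omega>. \<bar>U \<omega> - V \<omega>\<bar>)
    = (\<integral>\<omega>. \<bar>U \<omega> - V \<omega>\<bar>\<^sup>2 \<partial>M) - (\<integral>\<omega>. \<bar>U \<omega> - V \<omega>\<bar> \<partial>M)\<^sup>2"
proof -
  interpret prob_space M by (rule prob_space_uniform01[OF assms(1)])
  show ?thesis
    using integrable_distance_power[OF assms, of 1] integrable_distance_power[OF assms, of 2]
    by (subst variance_eq) auto
qed

lemma joint_df_moments:
  assumes P: "prob_space P" "sets P = sets borel" "uniform01 P fst" "uniform01 P snd"
    and C: "\<And>u v. u \<in> {0..1} \<Longrightarrow> v \<in> {0..1} \<Longrightarrow> C u v = measure P ({0..u} \<times> {0..v})"
    and e1: "(\<integral>z. \<bar>fst z - snd z\<bar> \<partial>P) = e1" and e2: "(\<integral>z. \<bar>fst z - snd z\<bar>\<^sup>2 \<partial>P) = e2"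
    and M: "prob_space M" and df: "has_joint_df M U V C"
  shows "prob_space.expectation M (\<lambda>\<omega>. \<bar>U \<omega> - V \<omega>\<bar>) = e1"
    and "prob_space.variance M (\<lambda>\<omega>. \<bar>U \<omega> - V \<omega>\<bar>) = e2 - e1\<^sup>2"
proof -
  have law: "distr M borel (\<lambda>\<omega>. (U \<omega>, V \<omega>)) = P"
    by (rule joint_law_unique[OF M df P C])
  have [measurable]: "U \<in> borel_measurable M" "V \<in> borel_measurable M"
    using df by (auto simp: has_joint_df_def)
  have E: "(\<integral>\<omega>. g (U \<omega>, V \<omega>) \<partial>M) = (\<integral>z. g z \<partial>P)" if [measurable]: "g \<in> borel_measurable borel"
    for g :: "real \<times> real \<Rightarrow> real"
    unfolding law[symmetric] by (subst integral_distr) auto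
  have "distr M borel U = distr P borel fst" "distr M borel V = distr P borel snd"
    unfolding law[symmetric] by (auto simp: distr_distr comp_def)
  then have U: "uniform01 M U" and V: "uniform01 M V"
    using P(3,4) by (auto simp: uniform01_def)
  show "prob_space.expectation M (\<lambda>\<omega>. \<bar>U \<omega> - V \<omega>\<bar>) = e1"
    using E[of "\<lambda>z. \<bar>fst z - snd z\<bar>"] e1 by simp
  then show "prob_space.variance M (\<lambda>\<omega>. \<bar>U \<omega> - V \<omega>\<bar>) = e2 - e1\<^sup>2"
    unfolding variance_distance[OF U V] using E[of "\<lambda>z. \<bar>fst z - snd z\<bar>\<^sup>2"] e2 by simp
qed


section \<open>The upper bound\<close>

text \<open>
  The fold \<open>x \<mapsto> \<bar>2x - 1\<bar>\<close> maps each half of the unit interval affinely onto the whole of it.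
\<close>

lemma nn_integral_unit_fold:
  fixes h :: "real \<Rightarrow> ennreal"
  assumes [measurable]: "h \<in> borel_measurable borel"
  shows "(\<integral>\<^sup>+ x. h \<bar>2 * x - 1\<bar> * indicator {0..1} x \<partial>lborel)
    = (\<integral>\<^sup>+ x. h x * indicator {0..1} x \<partial>lborel)"
proof -
  define g where "g x = h \<bar>2 * x - 1\<bar>" for x
  have [measurable]: "g \<in> borel_measurable borel" unfolding g_def by measurable
  let ?H = "\<integral>\<^sup>+ x. h x * indicator {0..1} x \<partial>lborel"
  have "(\<integral>\<^sup>+ x. g x * indicator {1/2..1} x \<partial>lborel)
      = ennreal (1/2) * (\<integral>\<^sup>+ t. g (1/2 + 1/2 * t) * indicator {0..1} t \<partial>lborel)"
    using nn_integral_interval_affine[of g "1/2" "1/2" 1] by simp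
  also have "(\<integral>\<^sup>+ t. g (1/2 + 1/2 * t) * indicator {0..1} t \<partial>lborel) = ?H"
    by (intro nn_integral_cong) (auto simp: g_def split: split_indicator)
  finally have upper: "(\<integral>\<^sup>+ x. g x * indicator {1/2..1} x \<partial>lborel) = ennreal (1/2) * ?H" .
  have "(\<integral>\<^sup>+ x. g x * indicator {0..1/2} x \<partial>lborel) = (\<integral>\<^sup>+ x. g (1 - x) * indicator {0..1/2} x \<partial>lborel)"
    by (intro nn_integral_cong) (auto simp: g_def abs_minus_commute split: split_indicator)
  also have "\<dots> = ennreal (1/2) * ?H"
    using upper by (subst nn_integral_interval_reflect) auto
  finally have "(\<integral>\<^sup>+ x. g x * indicator {0..1} x \<partial>lborel) = ennreal (1/2) * ?H + ennreal (1/2) * ?H"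
    using upper nn_integral_interval_split[of g 0 "1/2" 1] by simp
  also have "\<dots> = (ennreal (1/2) + ennreal (1/2)) * ?H" by (simp add: distrib_right)
  also have "ennreal (1/2) + ennreal (1/2) = 1" by (subst ennreal_plus[symmetric]) auto
  finally show ?thesis by (simp add: g_def)
qed

lemma nn_integral_unit_tail:
  fixes f F :: "real \<Rightarrow> real"
  assumes [measurable]: "f \<in> borel_measurable borel" and q: "0 \<le> q" "q \<le> 1"
    and F: "\<And>x. x \<in> {q..1} \<Longrightarrow> (F has_real_derivative f x) (at x)"
    and f: "\<And>x. x \<in> {q..1} \<Longrightarrow> 0 \<le> f x"
  shows "(\<integral>\<^sup>+ x. ennreal (if q < x then f x else 0) * indicator {0..1} x \<partial>lborel) = ennreal (F 1 - F q)"
proof -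
  have "(\<integral>\<^sup>+ x. ennreal (if q < x then f x else 0) * indicator {0..1} x \<partial>lborel)
      = (\<integral>\<^sup>+ x. ennreal (f x) * indicator {q..1} x \<partial>lborel)"
    using AE_lborel_singleton[of q] q
    by (intro nn_integral_cong_AE) (auto elim!: eventually_mono split: split_indicator)
  also have "\<dots> = ennreal (F 1 - F q)"
    using F f q by (intro nn_integral_FTC_Icc) auto
  finally show ?thesis .
qed

lemma uniform01_nn_expectation:
  assumes U: "uniform01 M U" and [measurable]: "h \<in> borel_measurable borel"
  shows "(\<integral>\<^sup>+ \<omega>. h (U \<omega>) \<partial>M) = (\<integral>\<^sup>+ x. h x * indicator {0..1} x \<partial>lborel)"
proof -
  have [measurable]: "U \<in> borel_measurable M" using U by (simp add: uniform01_def)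
  have "(\<integral>\<^sup>+ \<omega>. h (U \<omega>) \<partial>M) = (\<integral>\<^sup>+ x. h x \<partial>distr M borel U)"
    by (subst nn_integral_distr) auto
  then show ?thesis using U by (simp add: uniform01_def nn_integral_uniform_unit)
qed

text \<open>
  The integrals needed for the upper bound and for the Bertino copula all have this shape: after folding at
  \<open>1/2\<close>, the integrand vanishes below a threshold \<open>q\<close> and has a known antiderivative above it.
\<close>

lemma uniform01_fold_expectation:
  fixes f F :: "real \<Rightarrow> real"
  assumes U: "uniform01 M U" and [measurable]: "f \<in> borel_measurable borel" and q: "0 \<le> q" "q \<le> 1"
    and F: "\<And>x. x \<in> {q..1} \<Longrightarrow> (F has_real_derivative f x) (at x)"
    and f: "\<And>x. x \<in> {q..1} \<Longrightarrow> 0 \<le> f x"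
    and g: "\<And>x. x \<in> {0..1} \<Longrightarrow> g x = (if q < \<bar>2 * x - 1\<bar> then f \<bar>2 * x - 1\<bar> else 0)"
    and [measurable]: "g \<in> borel_measurable borel"
  shows "(\<integral>\<omega>. g (U \<omega>) \<partial>M) = F 1 - F q"
proof -
  have Um [measurable]: "U \<in> borel_measurable M" using U by (simp add: uniform01_def)
  have le: "F q \<le> F 1"
    by (rule DERIV_nonneg_imp_nondecreasing[OF q(2)]) (use F f in auto)
  have "(\<integral>\<^sup>+ \<omega>. ennreal (g (U \<omega>)) \<partial>M) = (\<integral>\<^sup>+ x. ennreal (g x) * indicator {0..1} x \<partial>lborel)"
    by (rule uniform01_nn_expectation[OF U]) measurable
  also have "\<dots> = (\<integral>\<^sup>+ x. (\<lambda>e. ennreal (if q < e then f e else 0)) \<bar>2 * x - 1\<bar> * indicator {0..1} x \<partial>lborel)"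
    by (intro nn_integral_cong) (auto simp: g split: split_indicator)
  also have "\<dots> = (\<integral>\<^sup>+ x. ennreal (if q < x then f x else 0) * indicator {0..1} x \<partial>lborel)"
    by (rule nn_integral_unit_fold) measurable
  also have "\<dots> = ennreal (F 1 - F q)"
    by (rule nn_integral_unit_tail[OF _ q F f]) auto
  finally have "(\<integral>\<^sup>+ \<omega>. ennreal (g (U \<omega>)) \<partial>M) = ennreal (F 1 - F q)" .
  moreover have "AE \<omega> in M. 0 \<le> g (U \<omega>)"
    using uniform01_AE[OF U]
  proof eventually_elim
    case (elim \<omega>)
    then have "\<bar>2 * U \<omega> - 1\<bar> \<le> 1" by auto
    then show ?case using f g[OF elim] by auto
  qed
  ultimately show ?thesis
    using le by (subst integral_eq_nn_integral) auto
qed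

lemma powr_three_halves: "0 \<le> x \<Longrightarrow> x powr (3/2) = sqrt x ^ 3" for x :: real
  by (cases "x = 0") (auto simp: powr_half_sqrt[symmetric] powr_power)

text \<open>
  The bound on \<open>E D\<^sup>2\<close> is the tangent line at slope \<open>q = \<surd>(1 - 2m)\<close> of a concave function of the mean.  It
  is integrated from \<open>\<bar>x - y\<bar> \<le> (\<bar>2x - 1\<bar> + \<bar>2y - 1\<bar>) / 2\<close> and the convexity and monotonicity
  of \<open>d \<mapsto> max 0 (d\<^sup>2 - q d)\<close>.
\<close>

lemma distance_second_moment_le:
  assumes U: "uniform01 M U" and V: "uniform01 M V"
    and m: "m = (\<integral>\<omega>. \<bar>U \<omega> - V \<omega>\<bar> \<partial>M)"
  shows "m \<le> 1/2" and "(\<integral>\<omega>. \<bar>U \<omega> - V \<omega>\<bar>\<^sup>2 \<partial>M) \<le> (1 - (1 - 2 * m) powr (3/2)) / 3"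
proof -
  interpret prob_space M by (rule prob_space_uniform01[OF U])
  have [measurable]: "U \<in> borel_measurable M" "V \<in> borel_measurable M"
    using U V by (auto simp: uniform01_def)
  have half: "\<bar>x - y\<bar> \<le> (\<bar>2 * x - 1\<bar> + \<bar>2 * y - 1\<bar>) / 2" for x y :: real
    by (auto simp: abs_if field_simps)
  note I = integrable_bounded_on_square[OF U V]
  have I1: "integrable M (\<lambda>\<omega>. \<bar>U \<omega> - V \<omega>\<bar>)" and I2: "integrable M (\<lambda>\<omega>. \<bar>U \<omega> - V \<omega>\<bar>\<^sup>2)"
    using integrable_distance_power[OF U V, of 1] integrable_distance_power[OF U V, of 2] by auto
  have E1: "(\<integral>\<omega>. \<bar>2 * W \<omega> - 1\<bar> \<partial>M) = 1/2" if "uniform01 M W" for W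
  proof -
    have "(\<integral>\<omega>. \<bar>2 * W \<omega> - 1\<bar> \<partial>M) = 1\<^sup>2 / 2 - 0\<^sup>2 / 2"
      by (rule uniform01_fold_expectation[OF that, where f="\<lambda>e. e" and q=0 and F="\<lambda>e. e\<^sup>2 / 2"])
        (auto intro!: derivative_eq_intros)
    then show ?thesis by simp
  qed
  have "\<bar>2 * x - 1\<bar> \<le> 1" if "x \<in> {0..1}" for x :: real using that by auto
  then have J: "integrable M (\<lambda>\<omega>. \<bar>2 * U \<omega> - 1\<bar>)" "integrable M (\<lambda>\<omega>. \<bar>2 * V \<omega> - 1\<bar>)"
    using I[of "\<lambda>z. \<bar>2 * fst z - 1\<bar>" 1] I[of "\<lambda>z. \<bar>2 * snd z - 1\<bar>" 1] by auto
  have "m \<le> (\<integral>\<omega>. (\<bar>2 * U \<omega> - 1\<bar> + \<bar>2 * V \<omega> - 1\<bar>) / 2 \<partial>M)"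
    unfolding m using J by (intro integral_mono I1 half) auto
  also have "\<dots> = 1/2"
    using J E1[OF U] E1[OF V] by simp
  finally show m2: "m \<le> 1/2" .
  have m0: "0 \<le> m" unfolding m by (intro Bochner_Integration.integral_nonneg) auto
  define q where "q = sqrt (1 - 2 * m)"
  have q: "0 \<le> q" "q \<le> 1" and qm: "m = (1 - q\<^sup>2) / 2" using m0 m2 by (auto simp: q_def)
  define \<phi> where "\<phi> d = max 0 (d\<^sup>2 - q * d)" for d
  have [measurable]: "\<phi> \<in> borel_measurable borel" unfolding \<phi>_def by measurable
  have pw: "\<bar>x - y\<bar>\<^sup>2 - q * \<bar>x - y\<bar> \<le> (\<phi> \<bar>2 * x - 1\<bar> + \<phi> \<bar>2 * y - 1\<bar>) / 2" for x y
  proof (cases "\<bar>x - y\<bar> \<le> q")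
    case True
    then have "\<bar>x - y\<bar> * \<bar>x - y\<bar> \<le> q * \<bar>x - y\<bar>" by (intro mult_right_mono) auto
    then have "\<bar>x - y\<bar>\<^sup>2 - q * \<bar>x - y\<bar> \<le> 0" by (simp only: power2_eq_square)
    then show ?thesis by (simp add: \<phi>_def max_def)
  next
    case False
    define e e' d where "e = \<bar>2 * x - 1\<bar>" and "e' = \<bar>2 * y - 1\<bar>" and "d = \<bar>x - y\<bar>"
    \<comment> \<open>Beyond \<open>q\<close> the function \<open>d (d - q)\<close> increases, and convexity compares its value at the mean \<open>s\<close> with the mean of its values.\<close>
    define s where "s = (e + e') / 2"
    have d: "q < d" "d \<le> s" using False half[of x y] by (auto simp: d_def s_def e_def e'_def)
    have "d * (d - q) \<le> s * (s - q)" using d q by (intro mult_mono) auto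
    also have "\<dots> = (e\<^sup>2 - q * e + (e'\<^sup>2 - q * e')) / 2 - ((e - e') / 2)\<^sup>2"
      by (simp add: s_def power2_eq_square field_simps)
    also have "\<dots> \<le> (e\<^sup>2 - q * e + (e'\<^sup>2 - q * e')) / 2"
      using zero_le_power2[of "(e - e') / 2"] by linarith
    also have "\<dots> \<le> (\<phi> e + \<phi> e') / 2"
      unfolding \<phi>_def by (intro divide_right_mono add_mono) auto
    finally show ?thesis
      unfolding e_def[symmetric] e'_def[symmetric] d_def[symmetric]
      by (simp add: power2_eq_square algebra_simps)
  qed
  have \<phi>1: "\<bar>\<phi> \<bar>2 * x - 1\<bar>\<bar> \<le> 1" if "x \<in> {0..1}" for x
  proof -
    have "\<bar>2 * x - 1\<bar> \<le> 1" using that by auto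
    then have "\<bar>2 * x - 1\<bar>\<^sup>2 \<le> 1" by (intro power_le_one) auto
    then show ?thesis using q by (auto simp: \<phi>_def max_def intro: order_trans[of _ "\<bar>2 * x - 1\<bar>\<^sup>2"])
  qed
  have IU: "integrable M (\<lambda>\<omega>. \<phi> \<bar>2 * U \<omega> - 1\<bar>)" and IV: "integrable M (\<lambda>\<omega>. \<phi> \<bar>2 * V \<omega> - 1\<bar>)"
    using I[of "\<lambda>z. \<phi> \<bar>2 * fst z - 1\<bar>" 1] I[of "\<lambda>z. \<phi> \<bar>2 * snd z - 1\<bar>" 1] \<phi>1 by auto
  have E\<phi>: "(\<integral>\<omega>. \<phi> \<bar>2 * W \<omega> - 1\<bar> \<partial>M) = 1/3 - q/2 + q^3/6" if W: "uniform01 M W" for W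
  proof -
    have "(\<integral>\<omega>. \<phi> \<bar>2 * W \<omega> - 1\<bar> \<partial>M) = (1^3 / 3 - q * 1\<^sup>2 / 2) - (q^3 / 3 - q * q\<^sup>2 / 2)"
    proof (rule uniform01_fold_expectation[OF W, where f="\<lambda>e. e\<^sup>2 - q * e" and q=q
          and F="\<lambda>e. e^3 / 3 - q * e\<^sup>2 / 2"])
      show "((\<lambda>e. e ^ 3 / 3 - q * e\<^sup>2 / 2) has_real_derivative x\<^sup>2 - q * x) (at x)" for x
        by (auto intro!: derivative_eq_intros)
      show "0 \<le> x\<^sup>2 - q * x" if "x \<in> {q..1}" for x
        using that q mult_right_mono[of q x x] by (simp add: power2_eq_square)
      fix x :: real
      define e where "e = \<bar>2 * x - 1\<bar>"
      have "e * e \<le> q * e" if "e \<le> q" using that by (intro mult_right_mono) (auto simp: e_def)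
      moreover have "q * e \<le> e * e" if "q < e" using that by (intro mult_right_mono) (auto simp: e_def)
      ultimately show "\<phi> \<bar>2 * x - 1\<bar> = (if q < \<bar>2 * x - 1\<bar> then \<bar>2 * x - 1\<bar>\<^sup>2 - q * \<bar>2 * x - 1\<bar> else 0)"
        unfolding e_def[symmetric] by (auto simp: \<phi>_def power2_eq_square max_def not_less)
    qed (use q in auto)
    then show ?thesis by (simp add: power2_eq_square power3_eq_cube)
  qed
  have "(\<integral>\<omega>. \<bar>U \<omega> - V \<omega>\<bar>\<^sup>2 \<partial>M) - q * m = (\<integral>\<omega>. \<bar>U \<omega> - V \<omega>\<bar>\<^sup>2 - q * \<bar>U \<omega> - V \<omega>\<bar> \<partial>M)"
    unfolding m using I1 I2 by simp
  also have "\<dots> \<le> (\<integral>\<omega>. (\<phi> \<bar>2 * U \<omega> - 1\<bar> + \<phi> \<bar>2 * V \<omega> - 1\<bar>) / 2 \<partial>M)"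
    using I1 I2 IU IV by (intro integral_mono pw) auto
  also have "\<dots> = 1/3 - q/2 + q^3/6" using IU IV E\<phi>[OF U] E\<phi>[OF V] by simp
  finally have "(\<integral>\<omega>. \<bar>U \<omega> - V \<omega>\<bar>\<^sup>2 \<partial>M) \<le> (1 - q^3) / 3"
    unfolding qm by (simp add: power2_eq_square power3_eq_cube field_simps)
  also have "q^3 = (1 - 2 * m) powr (3/2)"
    using m2 by (subst powr_three_halves) (auto simp: q_def)
  finally show "(\<integral>\<omega>. \<bar>U \<omega> - V \<omega>\<bar>\<^sup>2 \<partial>M) \<le> (1 - (1 - 2 * m) powr (3/2)) / 3" .
qed


section \<open>The Bertino copula\<close>

text \<open>
  The support of a Bertino copula: the outer intervals are exchanged by \<open>x \<mapsto> 1 - x\<close>, the middle one is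
  fixed.  For \<open>a = 0\<close> this is the comonotone coupling.
\<close>

definition outer_reflection :: "real \<Rightarrow> real \<Rightarrow> real" where
  "outer_reflection a x = (if x < a \<or> 1 - a < x then 1 - x else x)"

definition reflection_law :: "real \<Rightarrow> (real \<times> real) measure" where
  "reflection_law a = distr (uniform_measure lborel {0..1}) borel (\<lambda>x. (x, outer_reflection a x))"

lemma outer_reflection_measurable [measurable]: "outer_reflection a \<in> borel_measurable borel"
  unfolding outer_reflection_def by measurable

lemma sets_reflection_law [simp, measurable_cong]: "sets (reflection_law a) = sets borel"
  by (simp add: reflection_law_def)

lemma nn_integral_reflection_law:
  assumes [measurable]: "g \<in> borel_measurable borel"
  shows "(\<integral>\<^sup>+ z. g z \<partial>reflection_law a)
    = (\<integral>\<^sup>+ x. g (x, outer_reflection a x) * indicator {0..1} x \<partial>lborel)"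
  unfolding reflection_law_def
  by (subst nn_integral_distr) (auto simp: nn_integral_uniform_unit)

lemma fst_reflection_law: "uniform01 (reflection_law a) fst"
proof (rule uniform01I)
  fix h :: "real \<Rightarrow> ennreal" assume [measurable]: "h \<in> borel_measurable borel"
  show "(\<integral>\<^sup>+ z. h (fst z) \<partial>reflection_law a) = (\<integral>\<^sup>+ x. h x * indicator {0..1} x \<partial>lborel)"
    using nn_integral_reflection_law[of "\<lambda>z. h (fst z)" a] by simp
qed simp

lemma snd_reflection_law:
  assumes a: "0 \<le> a" "a \<le> 1/2"
  shows "uniform01 (reflection_law a) snd"
proof (rule uniform01I)
  fix h :: "real \<Rightarrow> ennreal" assume [measurable]: "h \<in> borel_measurable borel"
  define g where "g x = h (outer_reflection a x)" for x
  have [measurable]: "g \<in> borel_measurable borel" unfolding g_def by measurable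
  have 1: "(\<integral>\<^sup>+ x. g x * indicator {0..a} x \<partial>lborel) = (\<integral>\<^sup>+ x. h x * indicator {1 - a..1} x \<partial>lborel)"
  proof -
    have "(\<integral>\<^sup>+ x. g x * indicator {0..a} x \<partial>lborel) = (\<integral>\<^sup>+ x. h (1 - x) * indicator {0..a} x \<partial>lborel)"
    proof (rule nn_integral_cong_AE)
      show "AE x in lborel. g x * indicator {0..a} x = h (1 - x) * indicator {0..a} x"
        using AE_lborel_singleton[of a]
        by eventually_elim (auto simp: g_def outer_reflection_def split: split_indicator)
    qed
    then show ?thesis using nn_integral_interval_reflect[of h 0 a] by simp
  qed
  have 2: "(\<integral>\<^sup>+ x. g x * indicator {a..1 - a} x \<partial>lborel) = (\<integral>\<^sup>+ x. h x * indicator {a..1 - a} x \<partial>lborel)"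
    by (intro nn_integral_cong) (auto simp: g_def outer_reflection_def split: split_indicator)
  have 3: "(\<integral>\<^sup>+ x. g x * indicator {1 - a..1} x \<partial>lborel) = (\<integral>\<^sup>+ x. h x * indicator {0..a} x \<partial>lborel)"
  proof -
    have "(\<integral>\<^sup>+ x. g x * indicator {1 - a..1} x \<partial>lborel) = (\<integral>\<^sup>+ x. h (1 - x) * indicator {1 - a..1} x \<partial>lborel)"
    proof (rule nn_integral_cong_AE)
      show "AE x in lborel. g x * indicator {1 - a..1} x = h (1 - x) * indicator {1 - a..1} x"
        using AE_lborel_singleton[of "1 - a"]
        by eventually_elim (auto simp: g_def outer_reflection_def split: split_indicator)
    qed
    then show ?thesis using nn_integral_interval_reflect[of h "1 - a" 1] by simp
  qed
  have split: "(\<integral>\<^sup>+ x. f x * indicator {0..1} x \<partial>lborel) = (\<integral>\<^sup>+ x. f x * indicator {0..a} x \<partial>lborel)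
      + (\<integral>\<^sup>+ x. f x * indicator {a..1 - a} x \<partial>lborel) + (\<integral>\<^sup>+ x. f x * indicator {1 - a..1} x \<partial>lborel)"
    if "f \<in> borel_measurable borel" for f :: "real \<Rightarrow> ennreal"
    using nn_integral_interval_split[OF that, of 0 a "1 - a"]
      nn_integral_interval_split[OF that, of 0 "1 - a" 1] a by simp
  have "(\<integral>\<^sup>+ z. h (snd z) \<partial>reflection_law a) = (\<integral>\<^sup>+ x. g x * indicator {0..1} x \<partial>lborel)"
    using nn_integral_reflection_law[of "\<lambda>z. h (snd z)" a] by (simp add: g_def)
  also have "\<dots> = (\<integral>\<^sup>+ x. h x * indicator {0..1} x \<partial>lborel)"
    using split[of g] split[of h] by (simp add: 1 2 3 add_ac)
  finally show "(\<integral>\<^sup>+ z. h (snd z) \<partial>reflection_law a) = (\<integral>\<^sup>+ x. h x * indicator {0..1} x \<partial>lborel)" .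
qed simp

lemma reflection_law_distance_moment:
  assumes a: "0 \<le> a" "a \<le> 1/2" and j: "0 < j"
  shows "(\<integral>z. \<bar>fst z - snd z\<bar> ^ j \<partial>reflection_law a) = (1 - (1 - 2 * a) ^ Suc j) / real (Suc j)"
proof -
  have "(\<integral>z. \<bar>fst z - snd z\<bar> ^ j \<partial>reflection_law a)
      = (\<integral>x. \<bar>x - outer_reflection a x\<bar> ^ j \<partial>uniform_measure lborel {0..1})"
    unfolding reflection_law_def by (subst integral_distr) auto
  also have "\<dots> = (\<integral>z. \<bar>fst z - outer_reflection a (fst z)\<bar> ^ j \<partial>reflection_law a)"
    using uniform01_expectation[OF fst_reflection_law, of "\<lambda>x. \<bar>x - outer_reflection a x\<bar> ^ j" a] by simp
  also have "\<dots> = 1 ^ Suc j / real (Suc j) - (1 - 2 * a) ^ Suc j / real (Suc j)"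
  proof (rule uniform01_fold_expectation[OF fst_reflection_law, where f="\<lambda>e. e ^ j" and q="1 - 2 * a"
        and F="\<lambda>e. e ^ Suc j / real (Suc j)"])
    show "((\<lambda>e. e ^ Suc j / real (Suc j)) has_real_derivative x ^ j) (at x)" for x
      by (rule DERIV_cong[OF DERIV_cdivide[OF DERIV_pow]]) (simp del: of_nat_Suc)
    show "\<bar>x - outer_reflection a x\<bar> ^ j = (if 1 - 2 * a < \<bar>2 * x - 1\<bar> then \<bar>2 * x - 1\<bar> ^ j else 0)"
      if "x \<in> {0..1}" for x
    proof -
      have "(x < a \<or> 1 - a < x) = (1 - 2 * a < \<bar>2 * x - 1\<bar>)" using a by linarith
      then have "x - outer_reflection a x = (if 1 - 2 * a < \<bar>2 * x - 1\<bar> then 2 * x - 1 else 0)"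
        by (simp add: outer_reflection_def)
      then show ?thesis using j by simp
    qed
  qed (use a in auto)
  finally show ?thesis by (simp add: diff_divide_distrib)
qed

text \<open>
  The function \<open>t - \<delta>\<^sub>a t = min t a (1 - t)\<close> is concave, so its minimum over an interval is attained at an
  endpoint.
\<close>

lemma bertino_copula_eq:
  assumes a: "bertino_a x = a" "0 \<le> a" "a \<le> 1/2" and u: "u \<in> {0..1}" and v: "v \<in> {0..1}"
  shows "bertino_copula x u v
    = min u v - min (min u (min a (1 - u))) (min v (min a (1 - v)))"
proof -
  define \<psi> where "\<psi> t = min t (min a (1 - t))" for t
  have \<psi>: "t - bertino_diag a t = \<psi> t" for t
    using a by (auto simp: bertino_diag_def \<psi>_def min_def)
  have "(INF t\<in>{min u v..max u v}. t - bertino_diag a t) = min (\<psi> u) (\<psi> v)"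
    unfolding \<psi>
  proof (rule cInf_eq_minimum)
    show "min (\<psi> u) (\<psi> v) \<in> \<psi> ` {min u v..max u v}" by (auto simp: min_def)
    show "min (\<psi> u) (\<psi> v) \<le> y" if "y \<in> \<psi> ` {min u v..max u v}" for y
      using that by (auto simp: \<psi>_def)
  qed
  then show ?thesis by (simp add: bertino_copula_def a \<psi>_def)
qed

text \<open>
  The left-hand side adds the lengths of the parts of \<open>[0, u]\<close> that lie in the left, middle and right
  interval and are mapped into \<open>[0, v]\<close> by the outer reflection.
\<close>

lemma three_interval_lengths:
  fixes a u v :: real
  assumes a: "0 \<le> a" "a \<le> 1/2" and u: "0 \<le> u" "u \<le> 1" and v: "0 \<le> v" "v \<le> 1"
  shows "max 0 (min u a - (1 - v)) + (max 0 (min (min u v) (1 - a) - a) + max 0 (u - max (1 - a) (1 - v)))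
      = min u v - min (min u (min a (1 - u))) (min v (min a (1 - v)))"
proof -
  have "u \<le> a \<or> a < u \<and> u \<le> 1 - a \<or> 1 - a < u" "v \<le> a \<or> a < v \<and> v \<le> 1 - a \<or> 1 - a < v"
    "u \<le> v \<or> v < u" "u \<le> 1 - v \<or> 1 - v < u"
    by linarith+
  then show ?thesis
    using a u v by (elim disjE conjE) (simp_all add: min_def max_def)
qed

lemma measure_reflection_law_box:
  assumes a: "0 \<le> a" "a \<le> 1/2" and u: "u \<in> {0..1}" and v: "v \<in> {0..1}"
  shows "measure (reflection_law a) ({0..u} \<times> {0..v})
    = min u v - min (min u (min a (1 - u))) (min v (min a (1 - v)))"
proof -
  define A B C where "A = {1 - v..min u a}" and "B = {a..min (min u v) (1 - a)}"
    and "C = {max (1 - a) (1 - v)..u}"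
  have len: "emeasure lborel {l..r} = ennreal (max 0 (r - l))" for l r :: real
    by (auto simp: emeasure_lborel_Icc_eq max_def ennreal_neg)
  have "emeasure (reflection_law a) ({0..u} \<times> {0..v})
      = (\<integral>\<^sup>+ z. indicator ({0..u} \<times> {0..v}) z \<partial>reflection_law a)"
    by (rule nn_integral_indicator[symmetric]) (simp add: borel_closed closed_Times)
  also have "\<dots> = (\<integral>\<^sup>+ x. indicator ({0..u} \<times> {0..v}) (x, outer_reflection a x) * indicator {0..1} x \<partial>lborel)"
    by (rule nn_integral_reflection_law) (simp add: borel_closed closed_Times)
  also have "\<dots> = (\<integral>\<^sup>+ x. indicator A x + (indicator B x + indicator C x) \<partial>lborel)"
  proof (rule nn_integral_cong_AE)
    show "AE x in lborel. indicator ({0..u} \<times> {0..v}) (x, outer_reflection a x) * indicator {0..1} x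
        = (indicator A x + (indicator B x + indicator C x) :: ennreal)"
      using AE_lborel_singleton[of a] AE_lborel_singleton[of "1 - a"]
    proof eventually_elim
      case (elim x)
      consider "x < a" | "a < x" "x < 1 - a" | "1 - a < x" using elim by linarith
      then show ?case
        using u v a by cases (auto simp: A_def B_def C_def outer_reflection_def indicator_def)
    qed
  qed
  also have "\<dots> = ennreal (max 0 (min u a - (1 - v)) + (max 0 (min (min u v) (1 - a) - a)
      + max 0 (u - max (1 - a) (1 - v))))"
    by (simp add: nn_integral_add A_def B_def C_def len)
  also have "max 0 (min u a - (1 - v)) + (max 0 (min (min u v) (1 - a) - a) + max 0 (u - max (1 - a) (1 - v)))
      = min u v - min (min u (min a (1 - u))) (min v (min a (1 - v)))"
    using u v a by (intro three_interval_lengths) auto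
  finally have "emeasure (reflection_law a) ({0..u} \<times> {0..v})
      = ennreal (min u v - min (min u (min a (1 - u))) (min v (min a (1 - v))))" .
  moreover have "min (min u (min a (1 - u))) (min v (min a (1 - v))) \<le> min u v"
    by (intro min.mono min.cobounded1)
  ultimately show ?thesis by (simp only: measure_def enn2real_ennreal diff_ge_0_iff_ge)
qed

lemma bertino_attains:
  assumes m: "m \<in> {0..1/2}"
  shows "copula (bertino_copula (1 - 3 * m))"
    and "prob_space M \<Longrightarrow> has_joint_df M U V (bertino_copula (1 - 3 * m)) \<Longrightarrow>
      prob_space.expectation M (\<lambda>\<omega>. \<bar>U \<omega> - V \<omega>\<bar>) = m"
    and "prob_space M \<Longrightarrow> has_joint_df M U V (bertino_copula (1 - 3 * m)) \<Longrightarrow>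
      prob_space.variance M (\<lambda>\<omega>. \<bar>U \<omega> - V \<omega>\<bar>) = V_max m"
proof -
  define q where "q = sqrt (1 - 2 * m)"
  define a where "a = (1 - q) / 2"
  have q: "0 \<le> q" "q \<le> 1" "q\<^sup>2 = 1 - 2 * m" using m by (auto simp: q_def)
  have a: "0 \<le> a" "a \<le> 1/2" "1 - 2 * a = q" using q by (auto simp: a_def field_simps)
  have ba: "bertino_a (1 - 3 * m) = a" by (simp add: bertino_a_def a_def q_def)
  note U = fst_reflection_law[of a] and V = snd_reflection_law[OF a(1,2)]
  have C: "bertino_copula (1 - 3 * m) u v = measure (reflection_law a) ({0..u} \<times> {0..v})"
    if "u \<in> {0..1}" "v \<in> {0..1}" for u v
    using bertino_copula_eq[OF ba a(1,2) that] measure_reflection_law_box[OF a(1,2) that] by simp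
  have e1: "(\<integral>z. \<bar>fst z - snd z\<bar> \<partial>reflection_law a) = m"
    using reflection_law_distance_moment[OF a(1,2), of 1] q(3) by (simp add: a(3) power2_eq_square)
  have e2: "(\<integral>z. \<bar>fst z - snd z\<bar>\<^sup>2 \<partial>reflection_law a) = (1 - q^3) / 3"
    using reflection_law_distance_moment[OF a(1,2), of 2] by (simp add: a(3) power2_eq_square power3_eq_cube)
  have P: "prob_space (reflection_law a)" by (rule prob_space_uniform01[OF U])
  show "copula (bertino_copula (1 - 3 * m))"
    unfolding copula_def using P U V C by (intro exI[of _ "reflection_law a"]) auto
  assume M: "prob_space M" "has_joint_df M U V (bertino_copula (1 - 3 * m))"
  note mom = joint_df_moments[OF P sets_reflection_law U V C e1 e2 M]
  show "prob_space.expectation M (\<lambda>\<omega>. \<bar>U \<omega> - V \<omega>\<bar>) = m" by (rule mom(1))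
  show "prob_space.variance M (\<lambda>\<omega>. \<bar>U \<omega> - V \<omega>\<bar>) = V_max m"
    using mom(2) m by (simp add: V_max_def powr_three_halves q_def)
qed

section \<open>The dual potential for the lower bound\<close>

text \<open>
  The distance of \<open>x\<close> to the lattice \<open>c + \<theta>\<int>\<close>.
\<close>

definition phase_dist :: "real \<Rightarrow> real \<Rightarrow> real \<Rightarrow> real" where
  "phase_dist c \<theta> x = \<bar>x - c - \<theta> * of_int (round ((x - c) / \<theta>))\<bar>"

lemma phase_dist_measurable [measurable]: "phase_dist c \<theta> \<in> borel_measurable borel"
  unfolding phase_dist_def round_def by measurable

lemma phase_dist_le:
  assumes "0 < \<theta>" shows "phase_dist c \<theta> x \<le> \<theta> / 2"
proof -
  have "phase_dist c \<theta> x = \<theta> * \<bar>of_int (round ((x - c) / \<theta>)) - (x - c) / \<theta>\<bar>"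
    using assms by (simp add: phase_dist_def abs_mult_pos' abs_minus_commute field_simps flip: abs_mult)
  also have "\<dots> \<le> \<theta> * (1 / 2)"
    using assms by (intro mult_left_mono of_int_round_abs_le) auto
  finally show ?thesis by simp
qed

lemma phase_dist_eq:
  assumes "0 < \<theta>" and r: "\<bar>x - c - \<theta> * of_int k\<bar> \<le> \<theta> / 2"
  shows "phase_dist c \<theta> x = \<bar>x - c - \<theta> * of_int k\<bar>"
proof (cases "round ((x - c) / \<theta>) = k")
  case True
  then show ?thesis by (simp add: phase_dist_def)
next
  case False
  define j where "j = round ((x - c) / \<theta>)"
  have jk: "1 \<le> \<bar>real_of_int (j - k)\<bar>" using False by (simp add: j_def)
  have "\<theta> * 1 \<le> \<theta> * \<bar>real_of_int (j - k)\<bar>"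
    using assms(1) jk by (intro mult_left_mono) auto
  also have "\<dots> = \<bar>\<theta> * of_int j - \<theta> * of_int k\<bar>"
  proof -
    have "\<theta> * of_int j - \<theta> * of_int k = \<theta> * real_of_int (j - k)"
      by (simp add: algebra_simps)
    then show ?thesis using assms(1) by (simp add: abs_mult)
  qed
  finally have "\<theta> \<le> \<bar>\<theta> * of_int j - \<theta> * of_int k\<bar>" by simp
  moreover have "\<bar>x - c - \<theta> * of_int j\<bar> \<le> \<theta> / 2"
    using phase_dist_le[OF assms(1), of c x] by (simp add: phase_dist_def j_def)
  ultimately show ?thesis
    using r unfolding phase_dist_def j_def[symmetric] by linarith
qed

text \<open>
  On a circle of length \<open>2\<kappa>\<close>, the distance of \<open>x - y\<close> to the antipode \<open>\<kappa>\<close> of \<open>0\<close> is at least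
  \<open>\<bar>\<kappa> - r - s\<bar>\<close>: the points \<open>x\<close> and \<open>y\<close> are at most \<open>r + s\<close> apart when joined through the centre \<open>c\<close>, and at
  most \<open>2\<kappa> - r - s\<close> apart when joined through its antipode.
\<close>

lemma phase_dist_pair:
  assumes "0 < \<kappa>"
  shows "\<bar>\<kappa> - phase_dist c (2 * \<kappa>) x - phase_dist c (2 * \<kappa>) y\<bar> \<le> \<bar>\<bar>x - y\<bar> - \<kappa>\<bar>"
proof -
  define r s where "r = phase_dist c (2 * \<kappa>) x" and "s = phase_dist c (2 * \<kappa>) y"
  define i j where "i = round ((x - c) / (2 * \<kappa>))" and "j = round ((y - c) / (2 * \<kappa>))"
  define z where "z = 2 * \<kappa> * real_of_int (i - j)"
  have r: "0 \<le> r" "r \<le> \<kappa>" and s: "0 \<le> s" "s \<le> \<kappa>"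
    using phase_dist_le[of "2 * \<kappa>" c] assms by (auto simp: r_def s_def phase_dist_def)
  have re: "r = \<bar>x - c - 2 * \<kappa> * of_int i\<bar>" and se: "s = \<bar>y - c - 2 * \<kappa> * of_int j\<bar>"
    by (simp_all add: r_def s_def i_def j_def phase_dist_def)
  have z: "x - y = z + (x - c - 2 * \<kappa> * of_int i) - (y - c - 2 * \<kappa> * of_int j)"
    by (simp add: z_def algebra_simps)
  have "i - j = 0 \<or> i - j = 1 \<or> i - j = -1 \<or> i - j \<ge> 2 \<or> i - j \<le> -2" by linarith
  then consider "z = 0" | "z = 2 * \<kappa>" | "z = - 2 * \<kappa>" | "z \<ge> 4 * \<kappa>" | "z \<le> - 4 * \<kappa>"
  proof (elim disjE)
    assume "i - j \<ge> 2"
    then have "2 * \<kappa> * real_of_int (i - j) \<ge> 2 * \<kappa> * 2"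
      using assms by (intro mult_left_mono) auto
    then show ?thesis using that(4) by (simp add: z_def)
  next
    assume "i - j \<le> -2"
    then have "2 * \<kappa> * real_of_int (i - j) \<le> 2 * \<kappa> * (-2)"
      using assms by (intro mult_left_mono) auto
    then show ?thesis using that(5) by (simp add: z_def)
  qed (use that(1-3) in \<open>auto simp: z_def\<close>)
  then have "\<bar>\<kappa> - r - s\<bar> \<le> \<bar>\<bar>x - y\<bar> - \<kappa>\<bar>"
    using z r s re se assms by cases (linarith+)
  then show ?thesis by (simp add: r_def s_def)
qed

text \<open>
  A bump of slope between \<open>-v\<close> and \<open>0\<close>: concave with second derivative \<open>-2/N\<close> within distance \<open>Nv/2\<close> of
  the centre, convex with second derivative \<open>2/(N + 1)\<close> within distance \<open>(N + 1)v/2\<close> of the antipode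
  \<open>r = \<kappa>\<close>, and linear in between.  The curvatures make \<open>x \<mapsto> x - f' x / 2\<close> expand by \<open>(N + 1)/N\<close>
  near the centre, the slope of the map \<open>t \<mapsto> t + \<ell>(t)\<close> of the construction.
\<close>

definition potential :: "real \<Rightarrow> real \<Rightarrow> real \<Rightarrow> real \<Rightarrow> real" where
  "potential N v \<kappa> r = v * (\<kappa> / 2 - r) - v\<^sup>2 / 8 - (max 0 (N * v / 2 - r))\<^sup>2 / N
     + (max 0 ((N + 1) * v / 2 - (\<kappa> - r)))\<^sup>2 / (N + 1)"

text \<open>
  Cauchy-Schwarz with weights \<open>N\<close> and \<open>1\<close>.
\<close>

lemma square_diff_le:
  fixes N z X :: real
  assumes "0 < N"
  shows "(max 0 (z - X))\<^sup>2 / (N + 1) \<le> X\<^sup>2 + (max 0 z)\<^sup>2 / N"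
proof -
  define y where "y = max 0 z"
  have "(max 0 (z - X))\<^sup>2 \<le> (y - X)\<^sup>2"
    by (auto simp: y_def abs_le_square_iff[symmetric])
  also have "\<dots> \<le> (N + 1) * (X\<^sup>2 + y\<^sup>2 / N)"
  proof -
    have "(N + 1) * (X\<^sup>2 + y\<^sup>2 / N) - (y - X)\<^sup>2 = (N * X + y)\<^sup>2 / N"
      using assms by (simp add: field_simps power2_eq_square)
    moreover have "0 \<le> (N * X + y)\<^sup>2 / N" using assms by simp
    ultimately show ?thesis by linarith
  qed
  finally show ?thesis using assms by (simp add: y_def field_simps)
qed

text \<open>
  After removing the linear parts, the claim is that the two convex corrections \<open>Q\<close> are dominated by the
  square of \<open>X = \<kappa> - r - s - v/2\<close> together with the two concave corrections \<open>P\<close>.  One convex correction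
  is absorbed by \<open>X\<^sup>2\<close> and one \<open>P\<close>.  If both are present, then \<open>r\<close> and \<open>s\<close> are so large that
  each of them is at most \<open>X\<^sup>2 / (N + 1) \<le> X\<^sup>2 / 2\<close>.
\<close>

lemma potential_sum_le:
  fixes N v \<kappa> r s :: real
  assumes N: "1 \<le> N" and v: "0 \<le> v" and \<kappa>: "(2 * N + 1) * v / 2 \<le> \<kappa>"
  shows "potential N v \<kappa> r + potential N v \<kappa> s \<le> (\<kappa> - r - s)\<^sup>2"
proof -
  define X where "X = \<kappa> - r - s - v / 2"
  define P Q where "P r = (max 0 (N * v / 2 - r))\<^sup>2 / N"
    and "Q q = (max 0 ((N + 1) * v / 2 - q))\<^sup>2 / (N + 1)" for r q
  have pos: "0 \<le> P r" for r using N by (simp add: P_def)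
  have Qs: "Q (\<kappa> - s) \<le> X\<^sup>2 + P r"
  proof -
    have "N * v / 2 - r - X = (N + 1) * v / 2 - (\<kappa> - s)" by (simp add: X_def field_simps)
    then show ?thesis using square_diff_le[of N "N * v / 2 - r" X] N by (simp add: Q_def P_def)
  qed
  have Qr: "Q (\<kappa> - r) \<le> X\<^sup>2 + P s"
  proof -
    have "N * v / 2 - s - X = (N + 1) * v / 2 - (\<kappa> - r)" by (simp add: X_def field_simps)
    then show ?thesis using square_diff_le[of N "N * v / 2 - s" X] N by (simp add: Q_def P_def)
  qed
  have key: "Q (\<kappa> - r) + Q (\<kappa> - s) \<le> X\<^sup>2 + P r + P s"
  proof (cases "(N + 1) * v / 2 \<le> \<kappa> - r \<or> (N + 1) * v / 2 \<le> \<kappa> - s")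
    case True
    then show ?thesis
      using Qs Qr pos[of r] pos[of s] by (auto simp: Q_def[of "\<kappa> - r"] Q_def[of "\<kappa> - s"])
  next
    case False
    have half: "Q (\<kappa> - s') \<le> X\<^sup>2 / 2"
      if "X = \<kappa> - r' - s' - v / 2" "\<kappa> - r' < (N + 1) * v / 2" "\<kappa> - s' < (N + 1) * v / 2" for r' s'
    proof -
      have "N * v / 2 \<le> r'" using that(2) \<kappa> by (simp add: field_simps)
      then have "\<bar>max 0 ((N + 1) * v / 2 - (\<kappa> - s'))\<bar> \<le> \<bar>X\<bar>"
        using that by (simp add: field_simps)
      then have "(max 0 ((N + 1) * v / 2 - (\<kappa> - s')))\<^sup>2 \<le> X\<^sup>2"
        by (simp only: abs_le_square_iff power2_abs)
      then have "Q (\<kappa> - s') \<le> X\<^sup>2 / (N + 1)"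
        using N by (simp add: Q_def divide_right_mono)
      also have "\<dots> \<le> X\<^sup>2 / 2" using N by (intro divide_left_mono) auto
      finally show ?thesis .
    qed
    show ?thesis
      using half[of r s] half[of s r] False pos[of r] pos[of s] by (simp add: X_def)
  qed
  have "(\<kappa> - r - s)\<^sup>2 = X\<^sup>2 + v * (\<kappa> - r - s) - v\<^sup>2 / 4"
    by (simp add: X_def power2_eq_square field_simps)
  then show ?thesis
    using key by (simp add: potential_def P_def Q_def algebra_simps)
qed

text \<open>
  Equality in the duality inequality on the linear pieces of the potential: all corrections \<open>P\<close> and \<open>Q\<close>
  vanish, and so does \<open>X\<close>.
\<close>

lemma potential_sum_straight:
  fixes N v \<kappa> r s :: real
  assumes "N * v / 2 \<le> r" "N * v / 2 \<le> s" "\<kappa> - r - s = v / 2"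
    "0 \<le> v" "r \<le> \<kappa> - (N + 1) * v / 2" "s \<le> \<kappa> - (N + 1) * v / 2"
  shows "potential N v \<kappa> r + potential N v \<kappa> s = v\<^sup>2 / 4"
proof -
  have e: "potential N v \<kappa> r = v * (\<kappa> / 2 - r) - v\<^sup>2 / 8" "potential N v \<kappa> s = v * (\<kappa> / 2 - s) - v\<^sup>2 / 8"
    using assms by (auto simp: potential_def max_def)
  have k: "\<kappa> = r + s + v / 2" using assms(3) by linarith
  show ?thesis unfolding e unfolding k by (simp add: power2_eq_square field_simps)
qed

text \<open>
  Equality in the duality inequality between the concave and the convex piece: this is the equality case of
  the Cauchy-Schwarz estimate.
\<close>

lemma potential_sum_curved:
  fixes N v \<kappa> \<sigma> :: real
  assumes N: "1 \<le> N" and \<kappa>: "(2 * N + 1) * v / 2 \<le> \<kappa>"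
    and \<sigma>: "0 \<le> \<sigma>" "\<sigma> \<le> v / 2"
  shows "potential N v \<kappa> (N * \<sigma>) + potential N v \<kappa> (\<kappa> - (N + 1) * \<sigma>) = \<sigma>\<^sup>2"
proof -
  have le: "N * \<sigma> \<le> N * (v / 2)" "(N + 1) * \<sigma> \<le> (N + 1) * (v / 2)"
    using N \<sigma> by (auto intro!: mult_left_mono)
  have 1: "max 0 (N * v / 2 - N * \<sigma>) = N * (v / 2 - \<sigma>)"
    using le by (simp add: max_def field_simps)
  have 2: "max 0 ((N + 1) * v / 2 - (\<kappa> - N * \<sigma>)) = 0"
    using \<kappa> le by (simp add: max_def field_simps)
  have 3: "max 0 (N * v / 2 - (\<kappa> - (N + 1) * \<sigma>)) = 0"
    using \<kappa> le by (simp add: max_def field_simps)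
  have 4: "max 0 ((N + 1) * v / 2 - (\<kappa> - (\<kappa> - (N + 1) * \<sigma>))) = (N + 1) * (v / 2 - \<sigma>)"
    using le by (simp add: max_def field_simps)
  have sq: "(n * y)\<^sup>2 / n = n * y\<^sup>2" if "0 < n" for n y :: real
    using that by (simp add: power2_eq_square)
  have 5: "(N * (v / 2 - \<sigma>))\<^sup>2 / N = N * (v / 2 - \<sigma>)\<^sup>2"
    "((N + 1) * (v / 2 - \<sigma>))\<^sup>2 / (N + 1) = (N + 1) * (v / 2 - \<sigma>)\<^sup>2"
    using N by (auto intro!: sq)
  show ?thesis
    unfolding potential_def 1 2 3 4 5
    by (simp add: power2_eq_square algebra_simps)
qed

section \<open>Chain couplings\<close>

text \<open>
  A common description of both halves of the construction.  Here \<open>2\<kappa>\<close> is the translation length \<open>\<theta>\<close>;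
  there are \<open>n\<close> straight segments of length \<open>w\<close>, the first one starting at \<open>a\<close>, with step \<open>\<rho>\<close>; the curved
  segments start at \<open>b\<close> and have steps \<open>\<kappa> - v/2 + t/N\<close> and \<open>\<kappa> + v/2 - t/N\<close>.  The first
  alternative is the left half, where \<open>\<rho> = L\<close>, and the second one is the right half, where \<open>\<rho> = R\<close>.
\<close>

definition chain_geometry ::
    "nat \<Rightarrow> real \<Rightarrow> real \<Rightarrow> real \<Rightarrow> nat \<Rightarrow> real \<Rightarrow> real \<Rightarrow> real \<Rightarrow> bool" where
  "chain_geometry N v \<kappa> w n a \<rho> b \<longleftrightarrow>
     1 \<le> N \<and> 0 \<le> v \<and> 0 < \<kappa> \<and> 0 \<le> w \<and> w = \<kappa> - (2 * real N + 1) * v / 2 \<and>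
     2 * real n * \<rho> = 1 \<and>
     (n = N \<and> a = real N * v \<and> \<rho> = \<kappa> + v / 2 \<and> b = 0 \<or>
      n = N + 1 \<and> a = 0 \<and> \<rho> = \<kappa> - v / 2 \<and> b = w)"

text \<open>
  The integral of \<open>g\<close> against the measure \<open>\<nu>\<close>, the part of the chain law above the diagonal.
\<close>

definition chain_integral ::
    "nat \<Rightarrow> real \<Rightarrow> real \<Rightarrow> real \<Rightarrow> nat \<Rightarrow> real \<Rightarrow> real \<Rightarrow> real \<Rightarrow> (real \<Rightarrow> real \<Rightarrow> ennreal) \<Rightarrow> ennreal" where
  "chain_integral N v \<kappa> w n a \<rho> b g =
     (\<Sum>k<n. \<integral>\<^sup>+ s. g (2 * \<kappa> * real k + a + s) (2 * \<kappa> * real k + a + s + \<rho>) * indicator {0..w} s \<partial>lborel) +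
     ((\<Sum>k<N. ennreal (1 - real k / real N) *
        (\<integral>\<^sup>+ t. g (2 * \<kappa> * real k + b + t) (2 * \<kappa> * real k + b + t + (\<kappa> - v / 2 + t / real N))
          * indicator {0..real N * v} t \<partial>lborel)) +
      (\<Sum>k<N. ennreal ((real k + 1) / real N) *
        (\<integral>\<^sup>+ t. g (2 * \<kappa> * real k + b + t + (\<kappa> - v / 2 + t / real N)) (2 * \<kappa> * (real k + 1) + b + t)
          * indicator {0..real N * v} t \<partial>lborel)))"

text \<open>
  The weights \<open>1 - k/N\<close> and \<open>k/N\<close> with which consecutive curved segments project to the same interval add
  up to \<open>1\<close>.
\<close>

lemma telescoping_weights:
  fixes K :: "nat \<Rightarrow> ennreal"
  assumes "1 \<le> N"
  shows "(\<Sum>k<N. ennreal (1 - real k / real N) * K k) + (\<Sum>k<N. ennreal ((real k + 1) / real N) * K (Suc k))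
    = (\<Sum>k\<le>N. K k)"
proof -
  have 1: "(\<Sum>k<N. ennreal (1 - real k / real N) * K k) = (\<Sum>k\<le>N. ennreal (1 - real k / real N) * K k)"
    using assms by (simp add: lessThan_Suc_atMost[symmetric])
  have 2: "(\<Sum>k<N. ennreal ((real k + 1) / real N) * K (Suc k)) = (\<Sum>k\<le>N. ennreal (real k / real N) * K k)"
    by (subst sum.atMost_shift) (simp add: add.commute)
  show ?thesis unfolding 1 2 sum.distrib[symmetric]
  proof (rule sum.cong)
    fix k assume "k \<in> {..N}"
    then have "ennreal (1 - real k / real N) + ennreal (real k / real N) = 1"
      using assms by (subst ennreal_plus[symmetric]) auto
    then show "ennreal (1 - real k / real N) * K k + ennreal (real k / real N) * K k = K k"
      by (simp flip: distrib_right)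
  qed simp
qed

lemma nn_integral_interval_periods:
  fixes h :: "real \<Rightarrow> ennreal"
  assumes "h \<in> borel_measurable borel" "0 \<le> \<theta>"
  shows "(\<Sum>k<N. \<integral>\<^sup>+ x. h x * indicator {\<theta> * real k..\<theta> * (real k + 1)} x \<partial>lborel)
    = (\<integral>\<^sup>+ x. h x * indicator {0..\<theta> * real N} x \<partial>lborel)"
proof (induction N)
  case 0
  have "(\<integral>\<^sup>+ x. h x * indicator {0..0} x \<partial>lborel) = integral\<^sup>N lborel (\<lambda>x::real. 0)"
  proof (rule nn_integral_cong_AE)
    show "AE x in lborel. h x * indicator {0..0} x = 0"
      using AE_lborel_singleton[of "0::real"] by eventually_elim auto
  qed
  then show ?case by simp
next
  case (Suc N)
  then show ?case
    using nn_integral_interval_split[OF assms(1), of 0 "\<theta> * real N" "\<theta> * (real N + 1)"] assms(2)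
    by (simp add: add.commute mult_left_mono)
qed

text \<open>
  The projections of the segments tile the unit interval.  In one period these are, up to a cyclic order: the
  interval \<open>K\<close> of length \<open>Nv\<close>, on which the two families of curved segments share the density; two
  intervals of length \<open>w\<close> from the straight segments; and the interval of length \<open>(N + 1)v\<close> starting
  at \<open>O'\<close>, reached from both families with total weight \<open>(N + 1)/N\<close>, which cancels the expansion of
  \<open>t \<mapsto> t + t/N\<close>.  After \<open>N\<close> complete periods there remain \<open>K\<close> in the left half, and \<open>K\<close> between two
  straight pieces in the right half; both end at \<open>1\<close> because \<open>2 n \<rho> = 1\<close>.
\<close>

lemma chain_integral_marginal:
  fixes h :: "real \<Rightarrow> ennreal"
  assumes geo: "chain_geometry N v \<kappa> w n a \<rho> b"
    and h [measurable]: "h \<in> borel_measurable borel"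
  shows "chain_integral N v \<kappa> w n a \<rho> b (\<lambda>x y. h x + h y)
    = (\<integral>\<^sup>+ x. h x * indicator {0..1} x \<partial>lborel)"
proof -
  define J where "J \<alpha> \<beta> = (\<integral>\<^sup>+ x. h x * indicator {\<alpha>..\<beta>} x \<partial>lborel)" for \<alpha> \<beta>
  have N: "1 \<le> N" and v: "0 \<le> v" and \<kappa>: "0 < \<kappa>" and w: "0 \<le> w" "w = \<kappa> - (2 * real N + 1) * v / 2"
    and n: "2 * real n * \<rho> = 1"
    using geo by (auto simp: chain_geometry_def)
  have Nv: "0 \<le> real N * v" using v by simp
  have w': "w = \<kappa> - real N * v - v / 2" using w(2) by (simp add: field_simps)
  have split: "J \<alpha> \<beta> + J \<beta> \<gamma> = J \<alpha> \<gamma>" if "\<alpha> \<le> \<beta>" "\<beta> \<le> \<gamma>" for \<alpha> \<beta> \<gamma>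
    using nn_integral_interval_split[OF h that] by (simp add: J_def)
  have shift: "(\<integral>\<^sup>+ t. h (\<alpha> + t) * indicator {0..c} t \<partial>lborel) = J \<alpha> (\<alpha> + c)" for \<alpha> c
    using nn_integral_interval_shift[OF h, of \<alpha> c] by (simp add: J_def)
  define K where "K k = J (2 * \<kappa> * real k + b) (2 * \<kappa> * real k + b + real N * v)" for k :: nat
  define Z where "Z k = (\<integral>\<^sup>+ t. h (2 * \<kappa> * real k + b + t + (\<kappa> - v / 2 + t / real N))
          * indicator {0..real N * v} t \<partial>lborel)" for k :: nat
  define O' where "O' k = 2 * \<kappa> * real k + b + \<kappa> - v / 2" for k :: nat
  have Z: "ennreal ((real N + 1) / real N) * Z k = J (O' k) (O' k + (real N + 1) * v)" for k
  proof -
    have e: "2 * \<kappa> * real k + b + t + (\<kappa> - v / 2 + t / real N) = O' k + (real N + 1) / real N * t" for t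
      using N by (simp add: O'_def field_simps)
    have "(real N + 1) / real N * (real N * v) = (real N + 1) * v" using N by simp
    then show ?thesis
      using nn_integral_interval_affine[OF h, of "(real N + 1) / real N" "O' k" "real N * v"] N
      unfolding Z_def e J_def by simp
  qed
  have A: "(\<integral>\<^sup>+ s. (h (2 * \<kappa> * real k + a + s) + h (2 * \<kappa> * real k + a + s + \<rho>)) * indicator {0..w} s \<partial>lborel)
      = J (2 * \<kappa> * real k + a) (2 * \<kappa> * real k + a + w)
        + J (2 * \<kappa> * real k + a + \<rho>) (2 * \<kappa> * real k + a + \<rho> + w)" for k
    using shift[of "2 * \<kappa> * real k + a" w] shift[of "2 * \<kappa> * real k + a + \<rho>" w]
    by (simp add: distrib_right nn_integral_add add_ac)
  have B: "(\<integral>\<^sup>+ t. (h (2 * \<kappa> * real k + b + t) + h (2 * \<kappa> * real k + b + t + (\<kappa> - v / 2 + t / real N)))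
          * indicator {0..real N * v} t \<partial>lborel) = K k + Z k" for k
    using shift[of "2 * \<kappa> * real k + b" "real N * v"]
    by (simp add: distrib_right nn_integral_add Z_def K_def)
  have C: "(\<integral>\<^sup>+ t. (h (2 * \<kappa> * real k + b + t + (\<kappa> - v / 2 + t / real N)) + h (2 * \<kappa> * (real k + 1) + b + t))
          * indicator {0..real N * v} t \<partial>lborel) = Z k + K (Suc k)" for k
    using shift[of "2 * \<kappa> * (real k + 1) + b" "real N * v"]
    by (simp add: distrib_right nn_integral_add Z_def K_def add.commute[of 1])
  have ZZ: "(\<Sum>k<N. ennreal (1 - real k / real N) * Z k) + (\<Sum>k<N. ennreal ((real k + 1) / real N) * Z k)
      = (\<Sum>k<N. J (O' k) (O' k + (real N + 1) * v))"
    unfolding sum.distrib[symmetric]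
  proof (rule sum.cong)
    fix k assume "k \<in> {..<N}"
    then have "ennreal (1 - real k / real N) + ennreal ((real k + 1) / real N) = ennreal ((real N + 1) / real N)"
      using N by (subst ennreal_plus[symmetric]) (auto simp: field_simps)
    then show "ennreal (1 - real k / real N) * Z k + ennreal ((real k + 1) / real N) * Z k
        = J (O' k) (O' k + (real N + 1) * v)"
      by (simp add: Z flip: distrib_right)
  qed simp
  have "chain_integral N v \<kappa> w n a \<rho> b (\<lambda>x y. h x + h y)
    = (\<Sum>k<n. J (2 * \<kappa> * real k + a) (2 * \<kappa> * real k + a + w)
        + J (2 * \<kappa> * real k + a + \<rho>) (2 * \<kappa> * real k + a + \<rho> + w))
      + (((\<Sum>k<N. ennreal (1 - real k / real N) * K k) + (\<Sum>k<N. ennreal ((real k + 1) / real N) * K (Suc k)))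
        + ((\<Sum>k<N. ennreal (1 - real k / real N) * Z k) + (\<Sum>k<N. ennreal ((real k + 1) / real N) * Z k)))"
    unfolding chain_integral_def A B C by (simp add: distrib_left sum.distrib add_ac)
  also have "\<dots> = (\<Sum>k<n. J (2 * \<kappa> * real k + a) (2 * \<kappa> * real k + a + w)
        + J (2 * \<kappa> * real k + a + \<rho>) (2 * \<kappa> * real k + a + \<rho> + w))
      + ((\<Sum>k\<le>N. K k) + (\<Sum>k<N. J (O' k) (O' k + (real N + 1) * v)))"
    unfolding telescoping_weights[OF N] ZZ ..
  also have "\<dots> = J 0 1"
  proof (cases "n = N \<and> a = real N * v \<and> \<rho> = \<kappa> + v / 2 \<and> b = 0")
    case True
    have "J (2 * \<kappa> * real k + a) (2 * \<kappa> * real k + a + w) + J (2 * \<kappa> * real k + a + \<rho>) (2 * \<kappa> * real k + a + \<rho> + w)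
        + K k + J (O' k) (O' k + (real N + 1) * v) = J (2 * \<kappa> * real k) (2 * \<kappa> * (real k + 1))" for k
    proof -
      define p where "p = 2 * \<kappa> * real k"
      have "\<rho> = \<kappa> + v / 2" using True by simp
      then have "0 \<le> \<rho>" "w \<le> \<rho>" using v w' \<kappa> Nv by linarith+
      then have "J p (p + N * v) + J (p + N * v) (p + N * v + w) = J p (p + N * v + w)"
        "J p (p + N * v + w) + J (p + N * v + w) (p + N * v + \<rho>) = J p (p + N * v + \<rho>)"
        "J p (p + N * v + \<rho>) + J (p + N * v + \<rho>) (p + N * v + \<rho> + w) = J p (p + N * v + \<rho> + w)"
        using v w(1) by (auto intro!: split)
      then have "J p (p + N * v) + J (p + N * v) (p + N * v + w) + J (p + N * v + w) (p + N * v + \<rho>)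
          + J (p + N * v + \<rho>) (p + N * v + \<rho> + w) = J p (p + N * v + \<rho> + w)"
        by simp
      moreover have "O' k + (real N + 1) * v = p + N * v + \<rho>" "O' k = p + N * v + w"
        "2 * \<kappa> * (real k + 1) = p + N * v + \<rho> + w" "a = N * v" "b = 0"
        using True w(2) by (simp_all add: O'_def p_def field_simps)
      ultimately show ?thesis
        unfolding K_def p_def[symmetric] by (simp only: add_0_right) (simp only: add_ac)
    qed
    then have "(\<Sum>k<n. J (2 * \<kappa> * real k + a) (2 * \<kappa> * real k + a + w)
        + J (2 * \<kappa> * real k + a + \<rho>) (2 * \<kappa> * real k + a + \<rho> + w))
      + ((\<Sum>k\<le>N. K k) + (\<Sum>k<N. J (O' k) (O' k + (real N + 1) * v)))
      = (\<Sum>k<N. J (2 * \<kappa> * real k) (2 * \<kappa> * (real k + 1))) + K N"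
      using True by (simp add: lessThan_Suc_atMost[symmetric] sum.distrib[symmetric] add_ac)
    also have "\<dots> = J 0 (2 * \<kappa> * real N) + J (2 * \<kappa> * real N) (2 * \<kappa> * real N + real N * v)"
      using nn_integral_interval_periods[OF h, of "2 * \<kappa>" N] \<kappa> True by (simp add: J_def K_def)
    also have "\<dots> = J 0 (2 * \<kappa> * real N + real N * v)"
      using \<kappa> v by (intro split) auto
    also have "2 * \<kappa> * real N + real N * v = 1" using n True by (simp add: field_simps)
    finally show ?thesis .
  next
    case False
    then have F: "n = N + 1" "a = 0" "\<rho> = \<kappa> - v / 2" "b = w"
      using geo by (auto simp: chain_geometry_def)
    define D where "D k = J (2 * \<kappa> * real k) (2 * \<kappa> * real k + \<rho> + w)" for k
    have AK: "J (2 * \<kappa> * real k + a) (2 * \<kappa> * real k + a + w) + J (2 * \<kappa> * real k + a + \<rho>) (2 * \<kappa> * real k + a + \<rho> + w)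
        + K k = D k" for k
    proof -
      define p where "p = 2 * \<kappa> * real k"
      have "w \<le> \<rho>" using F(3) v w' Nv by linarith
      then have "J p (p + w) + J (p + w) (p + \<rho>) = J p (p + \<rho>)"
        "J p (p + \<rho>) + J (p + \<rho>) (p + \<rho> + w) = J p (p + \<rho> + w)"
        using v w(1) by (auto intro!: split)
      then have "J p (p + w) + J (p + w) (p + \<rho>) + J (p + \<rho>) (p + \<rho> + w) = J p (p + \<rho> + w)"
        by simp
      moreover have "p + w + N * v = p + \<rho>" using F w(2) by (simp add: field_simps)
      ultimately show ?thesis
        using F by (simp add: K_def D_def p_def[symmetric] add_ac)
    qed
    have DO: "D k + J (O' k) (O' k + (real N + 1) * v) = J (2 * \<kappa> * real k) (2 * \<kappa> * (real k + 1))" for k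
    proof -
      define p where "p = 2 * \<kappa> * real k"
      have "J p (p + \<rho> + w) + J (p + \<rho> + w) (p + 2 * \<kappa>) = J p (p + 2 * \<kappa>)"
        using F(3) w(1) w' v Nv by (intro split; linarith)
      moreover have "O' k + (real N + 1) * v = p + 2 * \<kappa>" "O' k = p + \<rho> + w" "2 * \<kappa> * (real k + 1) = p + 2 * \<kappa>"
        using F w(2) by (simp_all add: O'_def p_def field_simps)
      ultimately show ?thesis unfolding D_def p_def[symmetric] by (simp only:)
    qed
    have "(\<Sum>k<n. J (2 * \<kappa> * real k + a) (2 * \<kappa> * real k + a + w)
        + J (2 * \<kappa> * real k + a + \<rho>) (2 * \<kappa> * real k + a + \<rho> + w))
      + ((\<Sum>k\<le>N. K k) + (\<Sum>k<N. J (O' k) (O' k + (real N + 1) * v)))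
      = (\<Sum>k\<le>N. D k) + (\<Sum>k<N. J (O' k) (O' k + (real N + 1) * v))"
      unfolding AK[symmetric] F(1) Suc_eq_plus1[symmetric] lessThan_Suc_atMost sum.distrib
      by (simp only: add_ac)
    also have "\<dots> = (\<Sum>k<N. J (2 * \<kappa> * real k) (2 * \<kappa> * (real k + 1))) + D N"
      unfolding DO[symmetric] by (simp add: lessThan_Suc_atMost[symmetric] sum.distrib add_ac)
    also have "\<dots> = J 0 (2 * \<kappa> * real N) + J (2 * \<kappa> * real N) (2 * \<kappa> * real N + \<rho> + w)"
      using nn_integral_interval_periods[OF h, of "2 * \<kappa>" N] \<kappa> by (simp add: J_def D_def)
    also have "\<dots> = J 0 (2 * \<kappa> * real N + \<rho> + w)"
      using F(3) w(1) w' v Nv \<kappa> mult_nonneg_nonneg[of "2 * \<kappa>" "real N"]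
      by (intro split; linarith)
    also have "2 * \<kappa> * real N + \<rho> + w = 1" using n F w(2) by (simp add: field_simps)
    finally show ?thesis .
  qed
  finally show ?thesis by (simp add: J_def)
qed

text \<open>
  Both families of curved segments contribute the same integral \<open>T\<close>, since the step lengths \<open>\<kappa> - v/2 + t/N\<close>
  and \<open>\<kappa> + v/2 - t/N\<close> are exchanged by \<open>t \<mapsto> Nv - t\<close>; the weights add up to \<open>N + 1\<close>.
\<close>

lemma chain_integral_distance_power:
  assumes geo: "chain_geometry N v \<kappa> w n a \<rho> b"
  shows "chain_integral N v \<kappa> w n a \<rho> b (\<lambda>x y. ennreal (\<bar>x - y\<bar> ^ j))
    = ennreal (real n * w * \<rho> ^ j
        + real N * (real N + 1) * ((\<kappa> + v / 2) ^ Suc j - (\<kappa> - v / 2) ^ Suc j) / real (Suc j))"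
proof -
  have N: "1 \<le> N" and v: "0 \<le> v" and \<kappa>: "0 < \<kappa>" and w: "0 \<le> w" "w = \<kappa> - (2 * real N + 1) * v / 2"
    using geo by (auto simp: chain_geometry_def)
  have Nv: "0 \<le> real N * v" using v by simp
  have kv: "0 \<le> \<kappa> - v / 2" using w Nv by (simp add: field_simps)
  have \<rho>: "0 \<le> \<rho>" using geo kv v by (auto simp: chain_geometry_def)
  define T where "T = real N * ((\<kappa> + v / 2) ^ Suc j - (\<kappa> - v / 2) ^ Suc j) / real (Suc j)"
  have T0: "0 \<le> T"
    using kv v unfolding T_def by (intro divide_nonneg_nonneg mult_nonneg_nonneg)
      (auto intro!: power_mono simp del: power_Suc)
  have N0: "real N \<noteq> 0" using N by simp
  have tN: "0 \<le> t / N" "t / N \<le> v" if "t \<in> {0..real N * v}" for t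
    using that N by (auto simp: field_simps)
  have up: "(\<integral>\<^sup>+ t. ennreal ((\<kappa> - v / 2 + t / real N) ^ j) * indicator {0..real N * v} t \<partial>lborel) = ennreal T"
  proof -
    define F where "F t = real N * (\<kappa> - v / 2 + t / real N) ^ Suc j / real (Suc j)" for t
    have "(\<integral>\<^sup>+ t. ennreal ((\<kappa> - v / 2 + t / real N) ^ j) * indicator {0..real N * v} t \<partial>lborel)
        = ennreal (F (real N * v) - F 0)"
    proof (rule nn_integral_FTC_Icc)
      fix t assume t: "t \<in> {0..real N * v}"
      show "0 \<le> (\<kappa> - v / 2 + t / real N) ^ j" using tN[OF t] kv by simp
      have "((\<lambda>t. \<kappa> - v / 2 + t / real N) has_real_derivative 1 / real N) (at t)"
        using N0 by (auto intro!: derivative_eq_intros)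
      from DERIV_cdivide[OF DERIV_cmult[OF DERIV_power[OF this]]]
      show "(F has_real_derivative (\<kappa> - v / 2 + t / real N) ^ j) (at t)"
        unfolding F_def by (rule DERIV_cong) (use N0 in \<open>simp del: of_nat_Suc\<close>)
    qed (use Nv in auto)
    also have "F (real N * v) - F 0 = T"
      using N by (simp add: F_def T_def diff_divide_distrib[symmetric] right_diff_distrib[symmetric]
          add.commute del: power_Suc of_nat_Suc)
    finally show ?thesis .
  qed
  have down: "(\<integral>\<^sup>+ t. ennreal ((\<kappa> + v / 2 - t / real N) ^ j) * indicator {0..real N * v} t \<partial>lborel) = ennreal T"
  proof -
    define F where "F t = - real N * (\<kappa> + v / 2 - t / real N) ^ Suc j / real (Suc j)" for t
    have "(\<integral>\<^sup>+ t. ennreal ((\<kappa> + v / 2 - t / real N) ^ j) * indicator {0..real N * v} t \<partial>lborel)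
        = ennreal (F (real N * v) - F 0)"
    proof (rule nn_integral_FTC_Icc)
      fix t assume t: "t \<in> {0..real N * v}"
      show "0 \<le> (\<kappa> + v / 2 - t / real N) ^ j" using tN[OF t] kv by simp
      have "((\<lambda>t. \<kappa> + v / 2 - t / real N) has_real_derivative - 1 / real N) (at t)"
        using N0 by (auto intro!: derivative_eq_intros)
      from DERIV_cdivide[OF DERIV_cmult[OF DERIV_power[OF this]]]
      show "(F has_real_derivative (\<kappa> + v / 2 - t / real N) ^ j) (at t)"
        unfolding F_def by (rule DERIV_cong) (use N0 in \<open>simp del: of_nat_Suc\<close>)
    qed (use Nv in auto)
    also have "F (real N * v) - F 0 = T"
      using N by (simp add: F_def T_def diff_divide_distrib[symmetric] right_diff_distrib[symmetric]
          add.commute del: power_Suc of_nat_Suc)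
    finally show ?thesis .
  qed
  have A: "(\<integral>\<^sup>+ s. ennreal (\<bar>2 * \<kappa> * real k + a + s - (2 * \<kappa> * real k + a + s + \<rho>)\<bar> ^ j) * indicator {0..w} s \<partial>lborel)
      = ennreal (w * \<rho> ^ j)" for k
    using \<rho> w(1) by (simp add: nn_integral_cmult ennreal_mult mult.commute)
  have B: "(\<integral>\<^sup>+ t. ennreal (\<bar>2 * \<kappa> * real k + b + t - (2 * \<kappa> * real k + b + t + (\<kappa> - v / 2 + t / real N))\<bar> ^ j)
      * indicator {0..real N * v} t \<partial>lborel) = ennreal T" for k
    unfolding up[symmetric]
  proof (rule nn_integral_cong)
    fix t
    have "\<bar>2 * \<kappa> * real k + b + t - (2 * \<kappa> * real k + b + t + (\<kappa> - v / 2 + t / real N))\<bar> = \<kappa> - v / 2 + t / real N"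
      if "t \<in> {0..real N * v}" using tN[OF that] kv by simp
    then show "ennreal (\<bar>2 * \<kappa> * real k + b + t - (2 * \<kappa> * real k + b + t + (\<kappa> - v / 2 + t / real N))\<bar> ^ j)
      * indicator {0..real N * v} t = ennreal ((\<kappa> - v / 2 + t / real N) ^ j) * indicator {0..real N * v} t"
      by (simp split: split_indicator)
  qed
  have C: "(\<integral>\<^sup>+ t. ennreal (\<bar>2 * \<kappa> * real k + b + t + (\<kappa> - v / 2 + t / real N) - (2 * \<kappa> * (real k + 1) + b + t)\<bar> ^ j)
      * indicator {0..real N * v} t \<partial>lborel) = ennreal T" for k
    unfolding down[symmetric]
  proof (rule nn_integral_cong)
    fix t
    have "\<bar>2 * \<kappa> * real k + b + t + (\<kappa> - v / 2 + t / real N) - (2 * \<kappa> * (real k + 1) + b + t)\<bar> = \<kappa> + v / 2 - t / real N"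
      if "t \<in> {0..real N * v}" using tN[OF that] kv by (simp add: algebra_simps)
    then show "ennreal (\<bar>2 * \<kappa> * real k + b + t + (\<kappa> - v / 2 + t / real N) - (2 * \<kappa> * (real k + 1) + b + t)\<bar> ^ j)
      * indicator {0..real N * v} t = ennreal ((\<kappa> + v / 2 - t / real N) ^ j) * indicator {0..real N * v} t"
      by (simp split: split_indicator)
  qed
  have W: "(\<Sum>k<N. ennreal (1 - real k / real N) * ennreal T) + (\<Sum>k<N. ennreal ((real k + 1) / real N) * ennreal T)
      = ennreal ((real N + 1) * T)"
  proof -
    have "(\<Sum>k<N. ennreal (1 - real k / real N) * ennreal T) + (\<Sum>k<N. ennreal ((real k + 1) / real N) * ennreal T)
      = (\<Sum>k<N. ennreal ((real N + 1) / real N * T))"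
      unfolding sum.distrib[symmetric]
    proof (rule sum.cong)
      fix k assume "k \<in> {..<N}"
      then have "0 \<le> 1 - real k / real N" "0 \<le> (real k + 1) / real N" by auto
      then have "ennreal (1 - real k / real N) * ennreal T + ennreal ((real k + 1) / real N) * ennreal T
        = ennreal ((1 - real k / real N) * T + (real k + 1) / real N * T)"
        using T0 by (simp only: ennreal_mult[symmetric] ennreal_plus[symmetric] mult_nonneg_nonneg)
      also have "(1 - real k / real N) * T + (real k + 1) / real N * T = (real N + 1) / real N * T"
        using N by (simp add: field_simps)
      finally show "ennreal (1 - real k / real N) * ennreal T + ennreal ((real k + 1) / real N) * ennreal T
        = ennreal ((real N + 1) / real N * T)" .
    qed simp
    also have "\<dots> = ennreal ((real N + 1) * T)"
      using N T0 by (subst sum_ennreal) auto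
    finally show ?thesis .
  qed
  have "chain_integral N v \<kappa> w n a \<rho> b (\<lambda>x y. ennreal (\<bar>x - y\<bar> ^ j))
    = (\<Sum>k<n. ennreal (w * \<rho> ^ j)) + ennreal ((real N + 1) * T)"
    unfolding chain_integral_def A B C W ..
  also have "(\<Sum>k<n. ennreal (w * \<rho> ^ j)) = ennreal (real n * w * \<rho> ^ j)"
    using w(1) \<rho> by (subst sum_ennreal) auto
  also have "ennreal (real n * w * \<rho> ^ j) + ennreal ((real N + 1) * T)
      = ennreal (real n * w * \<rho> ^ j + (real N + 1) * T)"
    using w(1) \<rho> T0 by simp
  also have "(real N + 1) * T
      = real N * (real N + 1) * ((\<kappa> + v / 2) ^ Suc j - (\<kappa> - v / 2) ^ Suc j) / real (Suc j)"
    by (simp add: T_def mult_ac del: power_Suc of_nat_Suc)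
  finally show ?thesis .
qed

text \<open>
  Complementary slackness: the duality inequality is an equality on each segment.  The integrand is the
  indicator of the set where equality fails, which expresses this without referring to supports.
\<close>

lemma chain_integral_tight:
  assumes geo: "chain_geometry N v \<kappa> w n a \<rho> b"
    and c: "c = b + real N * v / 2"
    and f: "f = (\<lambda>x. potential (real N) v \<kappa> (phase_dist c (2 * \<kappa>) x))"
  shows "chain_integral N v \<kappa> w n a \<rho> b
      (\<lambda>x y. if f x + f y = (\<bar>x - y\<bar> - \<kappa>)\<^sup>2 then 0 else 1) = 0"
proof -
  have N: "1 \<le> N" and v: "0 \<le> v" and \<kappa>: "0 < \<kappa>" and w: "0 \<le> w" "w = \<kappa> - (2 * real N + 1) * v / 2"
    using geo by (auto simp: chain_geometry_def)
  have Nv: "0 \<le> real N * v" using v by simp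
  have kv: "0 \<le> \<kappa> - v / 2" using w Nv by (simp add: field_simps)
  have \<rho>: "0 \<le> \<rho>" using geo kv v by (auto simp: chain_geometry_def)
  have w': "w = \<kappa> - real N * v - v / 2" using w(2) by (simp add: field_simps)
  have wide: "(2 * real N + 1) * v / 2 \<le> \<kappa>" using w by simp
  have pd: "phase_dist c (2 * \<kappa>) x = r"
    if "x - c - 2 * \<kappa> * of_int k = e" "\<bar>e\<bar> = r" "r \<le> \<kappa>" for x e r k
    using phase_dist_eq[of "2 * \<kappa>" x c k] that \<kappa> by simp
  \<comment> \<open>Straight segments join the two linear pieces of the potential and have length \<open>\<kappa> \<plusminus> v/2\<close>.\<close>
  have A: "f x + f y = (\<bar>x - y\<bar> - \<kappa>)\<^sup>2"
    if s: "s \<in> {0..w}" and x: "x = 2 * \<kappa> * real k + a + s" and y: "y = x + \<rho>" for k s x y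
  proof -
    have s': "0 \<le> s" "s \<le> w" using s by auto
    obtain r r' where r: "phase_dist c (2 * \<kappa>) x = r" "phase_dist c (2 * \<kappa>) y = r'" "\<kappa> - r - r' = v / 2"
      "real N * v / 2 \<le> r" "real N * v / 2 \<le> r'" and d: "\<bar>\<rho> - \<kappa>\<bar> = v / 2"
    proof (cases "n = N \<and> a = real N * v \<and> \<rho> = \<kappa> + v / 2 \<and> b = 0")
      case True
      show thesis
      proof (rule that[of "real N * v / 2 + s" "\<kappa> - real N * v / 2 - v / 2 - s"])
        show "phase_dist c (2 * \<kappa>) x = real N * v / 2 + s"
        proof -
          have "x - c - 2 * \<kappa> * of_int (int k) = real N * v / 2 + s"
            using True x c by (simp add: field_simps)
          then show ?thesis
            by (rule pd) (use s' w' v Nv in linarith)+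
        qed
        show "phase_dist c (2 * \<kappa>) y = \<kappa> - real N * v / 2 - v / 2 - s"
        proof -
          have "y - c - 2 * \<kappa> * of_int (int k + 1) = - (\<kappa> - real N * v / 2 - v / 2 - s)"
            using True x y c by (simp add: field_simps)
          then show ?thesis
            by (rule pd) (use s' w' v Nv in linarith)+
        qed
      qed (insert True s' w' v Nv, (elim conjE, linarith)+)
    next
      case False
      then have F: "n = N + 1" "a = 0" "\<rho> = \<kappa> - v / 2" "b = w"
        using geo by (auto simp: chain_geometry_def)
      show thesis
      proof (rule that[of "w + real N * v / 2 - s" "real N * v / 2 + s"])
        show "phase_dist c (2 * \<kappa>) x = w + real N * v / 2 - s"
        proof -
          have "x - c - 2 * \<kappa> * of_int (int k) = - (w + real N * v / 2 - s)"
            using F x c by (simp add: field_simps)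
          then show ?thesis
            by (rule pd) (use s' w' v Nv in linarith)+
        qed
        show "phase_dist c (2 * \<kappa>) y = real N * v / 2 + s"
        proof -
          have "y - c - 2 * \<kappa> * of_int (int k) = real N * v / 2 + s"
            using F x y c w(2) by (simp add: field_simps)
          then show ?thesis
            by (rule pd) (use s' w' v Nv in linarith)+
        qed
      qed (insert F s' w' v Nv, linarith+)
    qed
    have "f x + f y = v\<^sup>2 / 4"
      unfolding f r(1,2) using r v
      by (intro potential_sum_straight) (auto simp: field_simps)
    also have "\<dots> = (\<bar>\<rho> - \<kappa>\<bar>)\<^sup>2" unfolding d by (simp add: power2_eq_square)
    also have "\<dots> = (\<bar>x - y\<bar> - \<kappa>)\<^sup>2" using y \<rho> by simp
    finally show ?thesis .
  qed
  \<comment> \<open>Curved segments join \<open>x\<close> and \<open>z\<close>, both at signed phase \<open>N\<tau>\<close>, to \<open>y\<close>, which lies \<open>(N + 1)\<tau>\<close> off the antipode.\<close>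
  have BC: "f x + f y = (\<bar>x - y\<bar> - \<kappa>)\<^sup>2 \<and> f y + f z = (\<bar>y - z\<bar> - \<kappa>)\<^sup>2"
    if t: "t \<in> {0..real N * v}" and x: "x = 2 * \<kappa> * real k + b + t"
      and y: "y = x + (\<kappa> - v / 2 + t / real N)" and z: "z = 2 * \<kappa> * (real k + 1) + b + t" for k t x y z
  proof -
    define \<tau> where "\<tau> = t / real N - v / 2"
    have tN: "0 \<le> t / real N" "t / real N \<le> v" using t N by (auto simp: field_simps)
    have t\<tau>: "t = real N * v / 2 + real N * \<tau>" using N by (simp add: \<tau>_def field_simps)
    have \<tau>: "\<bar>\<tau>\<bar> \<le> v / 2" using tN unfolding \<tau>_def by linarith
    have N\<tau>: "real N * \<bar>\<tau>\<bar> \<le> real N * (v / 2)" "(real N + 1) * \<bar>\<tau>\<bar> \<le> (real N + 1) * (v / 2)"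
      using N \<tau> by (auto intro!: mult_left_mono)
    have small: "real N * \<bar>\<tau>\<bar> \<le> \<kappa>" "(real N + 1) * \<bar>\<tau>\<bar> \<le> \<kappa>"
    proof -
      have "(real N + 1) * (v / 2) = real N * v / 2 + v / 2" by (simp add: field_simps)
      then show "real N * \<bar>\<tau>\<bar> \<le> \<kappa>" "(real N + 1) * \<bar>\<tau>\<bar> \<le> \<kappa>"
        using N\<tau> w(1) w' Nv v by linarith+
    qed
    have xx: "x - c - 2 * \<kappa> * real k = real N * \<tau>" "z - c - 2 * \<kappa> * (real k + 1) = real N * \<tau>"
      using x z c t\<tau> by (simp_all add: field_simps)
    have yy: "y - c - 2 * \<kappa> * real k = \<kappa> + (real N + 1) * \<tau>"
    proof -
      have "y = x + \<kappa> + \<tau>" using y by (simp add: \<tau>_def)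
      then show ?thesis using xx(1) by (simp add: algebra_simps)
    qed
    have aN: "\<bar>real N * \<tau>\<bar> = real N * \<bar>\<tau>\<bar>" by (simp add: abs_mult)
    have px: "phase_dist c (2 * \<kappa>) x = real N * \<bar>\<tau>\<bar>"
      using pd[of x "int k", OF _ aN] xx(1) small by simp
    have pz: "phase_dist c (2 * \<kappa>) z = real N * \<bar>\<tau>\<bar>"
      using pd[of z "int k + 1", OF _ aN] xx(2) small by simp
    have py: "phase_dist c (2 * \<kappa>) y = \<kappa> - (real N + 1) * \<bar>\<tau>\<bar>"
    proof (cases "0 \<le> \<tau>")
      case True
      have "y - c - 2 * \<kappa> * of_int (int k + 1) = - (\<kappa> - (real N + 1) * \<bar>\<tau>\<bar>)"
        using yy True by (simp add: algebra_simps)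
      then show ?thesis
        by (rule pd) (use small \<kappa> in auto)
    next
      case False
      then have "y - c - 2 * \<kappa> * of_int (int k) = \<kappa> - (real N + 1) * \<bar>\<tau>\<bar>"
        using yy by (simp add: algebra_simps)
      then show ?thesis
        by (rule pd) (use small \<kappa> in auto)
    qed
    have sum: "potential (real N) v \<kappa> (real N * \<bar>\<tau>\<bar>) + potential (real N) v \<kappa> (\<kappa> - (real N + 1) * \<bar>\<tau>\<bar>) = \<tau>\<^sup>2"
      using potential_sum_curved[of "real N" v \<kappa> "\<bar>\<tau>\<bar>"] N wide \<tau> by simp
    have "y - x = \<kappa> + \<tau>" using y by (simp add: \<tau>_def)
    then have "\<bar>x - y\<bar> - \<kappa> = \<tau>" using \<tau> kv by linarith
    moreover have "z - y = \<kappa> - \<tau>" using x y z by (simp add: \<tau>_def algebra_simps)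
    then have "\<bar>y - z\<bar> - \<kappa> = - \<tau>" using \<tau> kv by simp
    ultimately show ?thesis using sum by (simp add: f px py pz add.commute)
  qed
  have 1: "(\<integral>\<^sup>+ s. (if f (2 * \<kappa> * real k + a + s) + f (2 * \<kappa> * real k + a + s + \<rho>)
        = (\<bar>2 * \<kappa> * real k + a + s - (2 * \<kappa> * real k + a + s + \<rho>)\<bar> - \<kappa>)\<^sup>2 then 0 else 1)
        * indicator {0..w} s \<partial>lborel) = integral\<^sup>N lborel (\<lambda>s::real. 0)" for k
    using A[OF _ refl refl, of _ k] by (intro nn_integral_cong) (simp split: split_indicator)
  have 2: "(\<integral>\<^sup>+ t. (if f (2 * \<kappa> * real k + b + t) + f (2 * \<kappa> * real k + b + t + (\<kappa> - v / 2 + t / real N))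
        = (\<bar>2 * \<kappa> * real k + b + t - (2 * \<kappa> * real k + b + t + (\<kappa> - v / 2 + t / real N))\<bar> - \<kappa>)\<^sup>2 then 0 else 1)
        * indicator {0..real N * v} t \<partial>lborel) = integral\<^sup>N lborel (\<lambda>t::real. 0)" for k
    using BC[OF _ refl refl refl, of _ k] by (intro nn_integral_cong) (simp split: split_indicator)
  have 3: "(\<integral>\<^sup>+ t. (if f (2 * \<kappa> * real k + b + t + (\<kappa> - v / 2 + t / real N)) + f (2 * \<kappa> * (real k + 1) + b + t)
        = (\<bar>2 * \<kappa> * real k + b + t + (\<kappa> - v / 2 + t / real N) - (2 * \<kappa> * (real k + 1) + b + t)\<bar> - \<kappa>)\<^sup>2 then 0 else 1)
        * indicator {0..real N * v} t \<partial>lborel) = integral\<^sup>N lborel (\<lambda>t::real. 0)" for k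
    using BC[OF _ refl refl refl, of _ k] by (intro nn_integral_cong) (simp split: split_indicator)
  show ?thesis unfolding chain_integral_def 1 2 3 by simp
qed

section \<open>Optimality of chain couplings\<close>

lemma chain_integral_marginals_add:
  fixes h :: "real \<Rightarrow> ennreal"
  assumes [measurable]: "h \<in> borel_measurable borel"
  shows "chain_integral N v \<kappa> w n a \<rho> b (\<lambda>x y. h x) + chain_integral N v \<kappa> w n a \<rho> b (\<lambda>x y. h y)
    = chain_integral N v \<kappa> w n a \<rho> b (\<lambda>x y. h x + h y)"
proof -
  have add: "(\<integral>\<^sup>+ t. (h (X t) + h (Y t)) * indicator {0..c} t \<partial>lborel)
      = (\<integral>\<^sup>+ t. h (X t) * indicator {0..c} t \<partial>lborel) + (\<integral>\<^sup>+ t. h (Y t) * indicator {0..c} t \<partial>lborel)"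
    if [measurable]: "X \<in> borel_measurable borel" "Y \<in> borel_measurable borel" for X Y :: "real \<Rightarrow> real" and c :: real
    unfolding distrib_right by (rule nn_integral_add) measurable
  have A: "(\<integral>\<^sup>+ s. (h (2 * \<kappa> * real k + a + s) + h (2 * \<kappa> * real k + a + s + \<rho>)) * indicator {0..w} s \<partial>lborel)
      = (\<integral>\<^sup>+ s. h (2 * \<kappa> * real k + a + s) * indicator {0..w} s \<partial>lborel)
        + (\<integral>\<^sup>+ s. h (2 * \<kappa> * real k + a + s + \<rho>) * indicator {0..w} s \<partial>lborel)" for k
    by (rule add) measurable
  have B: "(\<integral>\<^sup>+ t. (h (2 * \<kappa> * real k + b + t) + h (2 * \<kappa> * real k + b + t + (\<kappa> - v / 2 + t / real N)))
        * indicator {0..real N * v} t \<partial>lborel)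
      = (\<integral>\<^sup>+ t. h (2 * \<kappa> * real k + b + t) * indicator {0..real N * v} t \<partial>lborel)
        + (\<integral>\<^sup>+ t. h (2 * \<kappa> * real k + b + t + (\<kappa> - v / 2 + t / real N)) * indicator {0..real N * v} t \<partial>lborel)" for k
    by (rule add) measurable
  have C: "(\<integral>\<^sup>+ t. (h (2 * \<kappa> * real k + b + t + (\<kappa> - v / 2 + t / real N)) + h (2 * \<kappa> * (real k + 1) + b + t))
        * indicator {0..real N * v} t \<partial>lborel)
      = (\<integral>\<^sup>+ t. h (2 * \<kappa> * real k + b + t + (\<kappa> - v / 2 + t / real N)) * indicator {0..real N * v} t \<partial>lborel)
        + (\<integral>\<^sup>+ t. h (2 * \<kappa> * (real k + 1) + b + t) * indicator {0..real N * v} t \<partial>lborel)" for k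
    by (rule add) measurable
  have regroup: "(x + (y + z)) + (x' + (y' + z')) = (x + x') + ((y + y') + (z + z'))"
    for x y z x' y' z' :: ennreal
    by (simp only: add_ac)
  have scale: "r * (x + y) = r * x + r * y" for r x y :: ennreal
    by (rule distrib_left)
  show ?thesis
    unfolding chain_integral_def A B C scale sum.distrib by (rule regroup)
qed

text \<open>
  The law \<open>\<nu> + S\<^sub># \<nu>\<close>, characterised by its integrals: the two summands are the integrals against \<open>\<nu>\<close> and
  against its reflection.
\<close>

definition chain_law ::
    "(real \<times> real) measure \<Rightarrow> nat \<Rightarrow> real \<Rightarrow> real \<Rightarrow> real \<Rightarrow> nat \<Rightarrow> real \<Rightarrow> real \<Rightarrow> real \<Rightarrow> bool" where
  "chain_law P N v \<kappa> w n a \<rho> b \<longleftrightarrow>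
     sets P = sets borel \<and>
     (\<forall>g\<in>borel_measurable borel. (\<integral>\<^sup>+ z. g z \<partial>P)
        = chain_integral N v \<kappa> w n a \<rho> b (\<lambda>x y. g (x, y)) + chain_integral N v \<kappa> w n a \<rho> b (\<lambda>x y. g (y, x)))"

definition chain_moment :: "nat \<Rightarrow> real \<Rightarrow> real \<Rightarrow> real \<Rightarrow> nat \<Rightarrow> real \<Rightarrow> nat \<Rightarrow> real" where
  "chain_moment N v \<kappa> w n \<rho> j = 2 * (real n * w * \<rho> ^ j
     + real N * (real N + 1) * ((\<kappa> + v / 2) ^ Suc j - (\<kappa> - v / 2) ^ Suc j) / real (Suc j))"

lemma chain_law_uniform:
  assumes geo: "chain_geometry N v \<kappa> w n a \<rho> b" and P: "chain_law P N v \<kappa> w n a \<rho> b"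
  shows "uniform01 P fst" and "uniform01 P snd"
proof -
  have sP [measurable_cong]: "sets P = sets borel" using P by (simp add: chain_law_def)
  have I: "(\<integral>\<^sup>+ z. g z \<partial>P)
        = chain_integral N v \<kappa> w n a \<rho> b (\<lambda>x y. g (x, y)) + chain_integral N v \<kappa> w n a \<rho> b (\<lambda>x y. g (y, x))"
    if "g \<in> borel_measurable borel" for g
    using P that by (auto simp: chain_law_def)
  have eq: "chain_integral N v \<kappa> w n a \<rho> b (\<lambda>x y. h x) + chain_integral N v \<kappa> w n a \<rho> b (\<lambda>x y. h y)
      = (\<integral>\<^sup>+ x. h x * indicator {0..1} x \<partial>lborel)"
    if "h \<in> borel_measurable borel" for h :: "real \<Rightarrow> ennreal"
    using chain_integral_marginals_add[OF that] chain_integral_marginal[OF geo that] by simp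
  show "uniform01 P fst"
  proof (rule uniform01I)
    fix h :: "real \<Rightarrow> ennreal" assume [measurable]: "h \<in> borel_measurable borel"
    show "(\<integral>\<^sup>+ z. h (fst z) \<partial>P) = (\<integral>\<^sup>+ x. h x * indicator {0..1} x \<partial>lborel)"
      using I[of "\<lambda>z. h (fst z)"] eq[of h] by simp
  qed measurable
  show "uniform01 P snd"
  proof (rule uniform01I)
    fix h :: "real \<Rightarrow> ennreal" assume [measurable]: "h \<in> borel_measurable borel"
    show "(\<integral>\<^sup>+ z. h (snd z) \<partial>P) = (\<integral>\<^sup>+ x. h x * indicator {0..1} x \<partial>lborel)"
      using I[of "\<lambda>z. h (snd z)"] eq[of h] by (simp add: add.commute)
  qed measurable
qed

lemma chain_law_moment:
  assumes geo: "chain_geometry N v \<kappa> w n a \<rho> b" and P: "chain_law P N v \<kappa> w n a \<rho> b"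
  shows "(\<integral>z. \<bar>fst z - snd z\<bar> ^ j \<partial>P) = chain_moment N v \<kappa> w n \<rho> j"
proof -
  have N: "1 \<le> N" and v: "0 \<le> v" and w: "0 \<le> w" "w = \<kappa> - (2 * real N + 1) * v / 2"
    using geo by (auto simp: chain_geometry_def)
  have "0 \<le> real N * v" using v by simp
  then have kv: "0 \<le> \<kappa> - v / 2" using w by (simp add: field_simps)
  have \<rho>: "0 \<le> \<rho>" using geo kv v by (auto simp: chain_geometry_def)
  have sP [measurable_cong]: "sets P = sets borel" using P by (simp add: chain_law_def)
  define T where "T = real n * w * \<rho> ^ j
     + real N * (real N + 1) * ((\<kappa> + v / 2) ^ Suc j - (\<kappa> - v / 2) ^ Suc j) / real (Suc j)"
  have "(\<kappa> - v / 2) ^ Suc j \<le> (\<kappa> + v / 2) ^ Suc j" using kv v by (intro power_mono) auto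
  then have T: "0 \<le> T" unfolding T_def using w \<rho>
    by (intro add_nonneg_nonneg mult_nonneg_nonneg divide_nonneg_nonneg) auto
  have "(\<integral>\<^sup>+ z. ennreal (\<bar>fst z - snd z\<bar> ^ j) \<partial>P)
      = chain_integral N v \<kappa> w n a \<rho> b (\<lambda>x y. ennreal (\<bar>x - y\<bar> ^ j))
        + chain_integral N v \<kappa> w n a \<rho> b (\<lambda>x y. ennreal (\<bar>x - y\<bar> ^ j))"
    using P by (simp add: chain_law_def abs_minus_commute del: power_abs)
  also have "\<dots> = ennreal (2 * T)"
    unfolding chain_integral_distance_power[OF geo] T_def[symmetric] using T
    by (subst ennreal_plus[symmetric]) auto
  finally have "(\<integral>\<^sup>+ z. ennreal (\<bar>fst z - snd z\<bar> ^ j) \<partial>P) = ennreal (2 * T)" .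
  then have "(\<integral>z. \<bar>fst z - snd z\<bar> ^ j \<partial>P) = 2 * T"
    using T by (subst integral_eq_nn_integral) auto
  then show ?thesis by (simp add: chain_moment_def T_def)
qed

text \<open>
  Weak duality bounds the right-hand side from below by twice the integral of the potential over the unit
  interval; by complementary slackness the left-hand side equals that number.
\<close>

lemma chain_law_optimal:
  assumes geo: "chain_geometry N v \<kappa> w n a \<rho> b" and P: "chain_law P N v \<kappa> w n a \<rho> b"
    and U: "uniform01 M U" and V: "uniform01 M V"
  shows "(\<integral>z. (\<bar>fst z - snd z\<bar> - \<kappa>)\<^sup>2 \<partial>P) \<le> (\<integral>\<omega>. (\<bar>U \<omega> - V \<omega>\<bar> - \<kappa>)\<^sup>2 \<partial>M)"
proof -
  have N: "1 \<le> N" and v: "0 \<le> v" and \<kappa>: "0 < \<kappa>" and w: "0 \<le> w" "w = \<kappa> - (2 * real N + 1) * v / 2"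
    using geo by (auto simp: chain_geometry_def)
  have sP [measurable_cong]: "sets P = sets borel" using P by (simp add: chain_law_def)
  note PU = chain_law_uniform(1)[OF geo P] and PV = chain_law_uniform(2)[OF geo P]
  define c where "c = b + real N * v / 2"
  define f where "f x = potential (real N) v \<kappa> (phase_dist c (2 * \<kappa>) x)" for x
  have [measurable]: "f \<in> borel_measurable borel"
    unfolding f_def potential_def by measurable
  have le: "f x + f y \<le> (\<bar>x - y\<bar> - \<kappa>)\<^sup>2" for x y
  proof -
    have "f x + f y \<le> (\<kappa> - phase_dist c (2 * \<kappa>) x - phase_dist c (2 * \<kappa>) y)\<^sup>2"
      unfolding f_def using N v w by (intro potential_sum_le) auto
    also have "\<dots> \<le> (\<bar>x - y\<bar> - \<kappa>)\<^sup>2"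
      using phase_dist_pair[OF \<kappa>] by (simp add: abs_le_square_iff)
    finally show ?thesis .
  qed
  have "compact (potential (real N) v \<kappa> ` {0..\<kappa>})"
    unfolding potential_def by (intro compact_continuous_image continuous_intros) (use N in auto)
  then have "bounded (potential (real N) v \<kappa> ` {0..\<kappa>})"
    by (rule compact_imp_bounded)
  then obtain B where "\<forall>y\<in>potential (real N) v \<kappa> ` {0..\<kappa>}. norm y \<le> B"
    unfolding bounded_iff by blast
  then have B: "\<bar>f x\<bar> \<le> B" for x
    using phase_dist_le[of "2 * \<kappa>" c x] \<kappa> by (auto simp: f_def phase_dist_def)
  have sum: "(\<integral>\<omega>. f (X \<omega>) + f (Y \<omega>) \<partial>Q) = 2 * (\<integral>x. f x \<partial>uniform_measure lborel {0..1})"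
    and intsum: "integrable Q (\<lambda>\<omega>. f (X \<omega>) + f (Y \<omega>))"
    and intsq: "integrable Q (\<lambda>\<omega>. (\<bar>X \<omega> - Y \<omega>\<bar> - \<kappa>)\<^sup>2)"
    if X: "uniform01 Q X" and Y: "uniform01 Q Y" for Q :: "'b measure" and X Y
  proof -
    interpret prob_space Q by (rule prob_space_uniform01[OF X])
    note I = integrable_bounded_on_square[OF X Y]
    have IX: "integrable Q (\<lambda>\<omega>. f (X \<omega>))" and IY: "integrable Q (\<lambda>\<omega>. f (Y \<omega>))"
      using I[of "\<lambda>z. f (fst z)" B] I[of "\<lambda>z. f (snd z)" B] B by auto
    show "integrable Q (\<lambda>\<omega>. f (X \<omega>) + f (Y \<omega>))" using IX IY by auto
    show "(\<integral>\<omega>. f (X \<omega>) + f (Y \<omega>) \<partial>Q) = 2 * (\<integral>x. f x \<partial>uniform_measure lborel {0..1})"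
      using IX IY uniform01_expectation[OF X, of f] uniform01_expectation[OF Y, of f] by simp
    have "integrable Q (\<lambda>\<omega>. \<bar>X \<omega> - Y \<omega>\<bar>\<^sup>2 - 2 * \<kappa> * \<bar>X \<omega> - Y \<omega>\<bar> + \<kappa>\<^sup>2)"
      using integrable_distance_power[OF X Y, of 1] integrable_distance_power[OF X Y, of 2] by auto
    then show "integrable Q (\<lambda>\<omega>. (\<bar>X \<omega> - Y \<omega>\<bar> - \<kappa>)\<^sup>2)"
      by (simp add: power2_diff algebra_simps)
  qed
  define defect where "defect z = (if f (fst z) + f (snd z) = (\<bar>fst z - snd z\<bar> - \<kappa>)\<^sup>2 then 0 else 1 :: ennreal)"
    for z
  have [measurable]: "defect \<in> borel_measurable borel" unfolding defect_def by measurable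
  have "(\<integral>\<^sup>+ z. defect z \<partial>P) = chain_integral N v \<kappa> w n a \<rho> b (\<lambda>x y. defect (x, y))
      + chain_integral N v \<kappa> w n a \<rho> b (\<lambda>x y. defect (x, y))"
    using P by (simp add: chain_law_def defect_def abs_minus_commute add.commute)
  also have "chain_integral N v \<kappa> w n a \<rho> b (\<lambda>x y. defect (x, y)) = 0"
    using chain_integral_tight[OF geo c_def, of f] by (simp add: defect_def f_def[abs_def])
  finally have "(\<integral>\<^sup>+ z. defect z \<partial>P) = 0" by simp
  then have "AE z in P. defect z = 0" by (subst (asm) nn_integral_0_iff_AE) auto
  then have "AE z in P. (\<bar>fst z - snd z\<bar> - \<kappa>)\<^sup>2 = f (fst z) + f (snd z)"
    by eventually_elim (auto simp: defect_def split: if_splits)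
  then have "(\<integral>z. (\<bar>fst z - snd z\<bar> - \<kappa>)\<^sup>2 \<partial>P) = (\<integral>z. f (fst z) + f (snd z) \<partial>P)"
    by (intro integral_cong_AE) auto
  also have "\<dots> = (\<integral>\<omega>. f (U \<omega>) + f (V \<omega>) \<partial>M)"
    using sum[OF PU PV] sum[OF U V] by simp
  also have "\<dots> \<le> (\<integral>\<omega>. (\<bar>U \<omega> - V \<omega>\<bar> - \<kappa>)\<^sup>2 \<partial>M)"
    by (intro integral_mono intsum intsq U V le)
  finally show ?thesis .
qed

text \<open>
  At equal means, comparing \<open>E (D - \<kappa>)\<^sup>2\<close> is the same as comparing \<open>E D\<^sup>2\<close>.
\<close>

lemma chain_law_minimal_second_moment:
  assumes geo: "chain_geometry N v \<kappa> w n a \<rho> b" and P: "chain_law P N v \<kappa> w n a \<rho> b"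
    and U: "uniform01 M U" and V: "uniform01 M V"
    and mean: "(\<integral>\<omega>. \<bar>U \<omega> - V \<omega>\<bar> \<partial>M) = chain_moment N v \<kappa> w n \<rho> 1"
  shows "chain_moment N v \<kappa> w n \<rho> 2 \<le> (\<integral>\<omega>. \<bar>U \<omega> - V \<omega>\<bar>\<^sup>2 \<partial>M)"
proof -
  have expand: "(\<integral>\<omega>. (\<bar>X \<omega> - Y \<omega>\<bar> - \<kappa>)\<^sup>2 \<partial>Q)
      = (\<integral>\<omega>. \<bar>X \<omega> - Y \<omega>\<bar>\<^sup>2 \<partial>Q) - 2 * \<kappa> * (\<integral>\<omega>. \<bar>X \<omega> - Y \<omega>\<bar> \<partial>Q) + \<kappa>\<^sup>2"
    if X: "uniform01 Q X" and Y: "uniform01 Q Y" for Q :: "'b measure" and X Y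
  proof -
    interpret prob_space Q by (rule prob_space_uniform01[OF X])
    have "(\<lambda>\<omega>. (\<bar>X \<omega> - Y \<omega>\<bar> - \<kappa>)\<^sup>2) = (\<lambda>\<omega>. \<bar>X \<omega> - Y \<omega>\<bar>\<^sup>2 - 2 * \<kappa> * \<bar>X \<omega> - Y \<omega>\<bar> + \<kappa>\<^sup>2)"
      by (simp add: fun_eq_iff power2_diff)
    then show ?thesis
      using integrable_distance_power[OF X Y, of 1] integrable_distance_power[OF X Y, of 2]
      by (simp add: prob_space del: power2_abs)
  qed
  show ?thesis
    using chain_law_optimal[OF geo P U V] mean
      expand[OF U V] expand[OF chain_law_uniform[OF geo P]]
      chain_law_moment[OF geo P, of 1] chain_law_moment[OF geo P, of 2]
    by (simp del: power2_abs)
qed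

section \<open>The minimising copula as a chain coupling\<close>

lemma reciprocal_interval_iff:
  assumes "0 < m" "1 \<le> (N::nat)"
  shows "m \<in> {1 / (2 * real N + 2) <.. 1 / (2 * real N)} \<longleftrightarrow> real N \<le> 1 / (2 * m) \<and> 1 / (2 * m) < real N + 1"
proof -
  have "m \<le> 1 / (2 * real N) \<longleftrightarrow> real N \<le> 1 / (2 * m)" "1 / (2 * real N + 2) < m \<longleftrightarrow> 1 / (2 * m) < real N + 1"
    using assms by (simp_all add: field_simps)
  then show ?thesis by auto
qed

lemma reciprocal_interval_ex1:
  assumes "m \<in> {0<..1/2}"
  shows "\<exists>!N::nat. 1 \<le> N \<and> m \<in> {1 / (2 * real N + 2) <.. 1 / (2 * real N)}"
proof -
  have m: "0 < m" and y: "1 \<le> 1 / (2 * m)" using assms by (auto simp: field_simps)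
  define N where "N = nat \<lfloor>1 / (2 * m)\<rfloor>"
  have N: "real N \<le> 1 / (2 * m)" "1 / (2 * m) < real N + 1"
    using y unfolding N_def by linarith+
  then have N1: "1 \<le> N" using y by linarith
  show ?thesis
  proof (rule ex1I[of _ N])
    show "1 \<le> N \<and> m \<in> {1 / (2 * real N + 2) <.. 1 / (2 * real N)}"
      using reciprocal_interval_iff[OF m N1] N N1 by blast
    fix k :: nat assume k: "1 \<le> k \<and> m \<in> {1 / (2 * real k + 2) <.. 1 / (2 * real k)}"
    then have "real k \<le> 1 / (2 * m)" "1 / (2 * m) < real k + 1"
      using reciprocal_interval_iff[OF m, of k] by blast+
    then have "real k < real N + 1" "real N < real k + 1" using N by linarith+
    then show "k = N" by linarith
  qed
qed

text \<open>
  The translation from the explicit segments; in both halves the curved steps start at \<open>\<kappa> - v/2\<close>, which is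
  \<open>L - v\<close> in the left half and \<open>R\<close> in the right half.
\<close>

lemma chain_law_cop_pi:
  assumes N: "cop_N x = N" "1 \<le> N" and \<theta>: "cop_theta x = 2 * \<kappa>" and v: "cop_v x = v"
    and half: "left_half x \<Longrightarrow> n = N \<and> a = real N * v \<and> b = 0 \<and> \<rho> = cop_L x
        \<and> w = cop_p x * cop_L x \<and> \<kappa> - v / 2 = cop_L x - v"
      "\<not> left_half x \<Longrightarrow> n = N + 1 \<and> a = 0 \<and> b = w \<and> \<rho> = cop_R x
        \<and> w = cop_p x * cop_R x \<and> \<kappa> - v / 2 = cop_R x"
  shows "chain_law (cop_pi x) N v \<kappa> w n a \<rho> b"
proof -
  define A B C where "A k s = (2 * \<kappa> * real k + a + s, 2 * \<kappa> * real k + a + s + \<rho>)"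
    and "B k t = (2 * \<kappa> * real k + b + t, 2 * \<kappa> * real k + b + t + (\<kappa> - v / 2 + t / real N))"
    and "C k t = (2 * \<kappa> * real k + b + t + (\<kappa> - v / 2 + t / real N), 2 * \<kappa> * (real k + 1) + b + t)"
    for k :: nat and s t :: real
  have [measurable]: "A k \<in> borel_measurable borel" "B k \<in> borel_measurable borel"
    "C k \<in> borel_measurable borel" for k
    unfolding A_def B_def C_def divide_inverse
    by (intro borel_measurable_continuous_onI continuous_intros)+
  have N0: "{0..N - 1} = {..<N}" using N(2) by auto
  define \<nu> where "\<nu> = measure_add (measure_sum {..<n} (\<lambda>k. segment_measure 1 (A k) w))
     (measure_add (measure_sum {..<N} (\<lambda>k. segment_measure (1 - real k / real N) (B k) (real N * v)))
                  (measure_sum {..<N} (\<lambda>k. segment_measure ((real k + 1) / real N) (C k) (real N * v))))"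
  have \<nu>: "cop_nu x = \<nu>"
  proof (cases "left_half x")
    case True
    note h = half(1)[OF True]
    have "A_L x = A" "B_L x = B" "C_L x = C"
      using h by (auto simp: fun_eq_iff A_L_def B_L_def C_L_def ell_L_def A_def B_def C_def N(1) \<theta> v)
    then show ?thesis
      using True h N0 by (simp add: cop_nu_def \<nu>_def N(1) v cop_alpha_def cop_beta_def)
  next
    case False
    note h = half(2)[OF False]
    have "A_R x = A" "B_R x = B" "C_R x = C"
      using h by (auto simp: fun_eq_iff A_R_def B_R_def C_R_def ell_R_def A_def B_def C_def N(1) \<theta> v)
    moreover have "{0..N} = {..<n}" using h by auto
    ultimately show ?thesis
      using False h N0 by (simp add: cop_nu_def \<nu>_def N(1) v cop_alpha_def cop_beta_def)
  qed
  have I: "(\<integral>\<^sup>+ z. g z \<partial>\<nu>) = chain_integral N v \<kappa> w n a \<rho> b (\<lambda>x y. g (x, y))"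
    if [measurable]: "g \<in> borel_measurable borel" for g
    unfolding \<nu>_def chain_integral_def
    by (simp add: nn_integral_measure_add nn_integral_measure_sum nn_integral_segment_measure A_def B_def C_def)
  have swap [measurable]: "prod.swap \<in> borel_measurable (borel :: (real \<times> real) measure)"
    by (intro borel_measurable_continuous_onI continuous_on_swap)
  have s\<nu> [measurable_cong]: "sets \<nu> = sets borel" by (simp add: \<nu>_def)
  have "(\<integral>\<^sup>+ z. g z \<partial>cop_pi x) = chain_integral N v \<kappa> w n a \<rho> b (\<lambda>x y. g (x, y))
      + chain_integral N v \<kappa> w n a \<rho> b (\<lambda>x y. g (y, x))"
    if [measurable]: "g \<in> borel_measurable borel" for g
  proof -
    have "(\<integral>\<^sup>+ z. g z \<partial>cop_pi x) = (\<integral>\<^sup>+ z. g z \<partial>\<nu>) + (\<integral>\<^sup>+ z. g (prod.swap z) \<partial>\<nu>)"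
      unfolding cop_pi_def \<nu> by (simp add: nn_integral_measure_add s\<nu> nn_integral_distr)
    then show ?thesis using I[of g] I[of "\<lambda>z. g (prod.swap z)"] by simp
  qed
  then show ?thesis by (simp add: chain_law_def cop_pi_def)
qed

lemma powr_three_halves_square:
  fixes K v :: real
  assumes "0 < K" "0 \<le> v"
  shows "2 * (K * v\<^sup>2) powr (3/2) / (3 * sqrt K) = 2 / 3 * K * v ^ 3"
proof -
  have "(K * v\<^sup>2) powr (3/2) = (sqrt K * v) ^ 3"
    using assms by (simp add: powr_three_halves real_sqrt_mult)
  also have "\<dots> = (sqrt K)\<^sup>2 * sqrt K * v ^ 3" by (simp add: power2_eq_square power3_eq_cube)
  also have "\<dots> = K * sqrt K * v ^ 3" using assms by simp
  finally show ?thesis using assms by simp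
qed

text \<open>
  With \<open>K = N (N + 1)\<close> and \<open>\<Delta>\<close> the distance of \<open>m\<close> to the nearest endpoint, the parameter \<open>v\<close>
  satisfies \<open>K v\<^sup>2 = \<Delta>\<close>.  As \<open>\<Delta> \<le> 1 / (4K)\<close>, this gives \<open>2 K v \<le> 1\<close>, so that the straight segments
  have nonnegative length.  In terms of \<open>v\<close> the minimal variance is the polynomial
  \<open>2/3 K v\<^sup>3 - K\<^sup>2 v\<^sup>4\<close>, and the moments of the chain law are compared with it using \<open>2 K L = N + 1\<close> and
  \<open>2 K R = N\<close>.
\<close>

lemma min_copula_is_chain:
  assumes m: "m \<in> {0<..1/2}"
  obtains N v \<kappa> w n a \<rho> b where "chain_geometry N v \<kappa> w n a \<rho> b"
    "chain_law (cop_pi (1 - 3 * m)) N v \<kappa> w n a \<rho> b"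
    "chain_moment N v \<kappa> w n \<rho> 1 = m" "chain_moment N v \<kappa> w n \<rho> 2 - m\<^sup>2 = V_min m"
proof -
  obtain N :: nat where N: "1 \<le> N" "m \<in> {1 / (2 * real N + 2) <.. 1 / (2 * real N)}"
    and uniq: "\<And>k. 1 \<le> k \<and> m \<in> {1 / (2 * real k + 2) <.. 1 / (2 * real k)} \<Longrightarrow> k = N"
    using reciprocal_interval_ex1[OF m] by blast
  define x where "x = 1 - 3 * m"
  have mx: "(1 - x) / 3 = m" by (simp add: x_def)
  have iff: "x \<in> {1 - 3 / (2 * real k) ..< 1 - 3 / (2 * real k + 2)}
      \<longleftrightarrow> m \<in> {1 / (2 * real k + 2) <.. 1 / (2 * real k)}" for k :: nat
  proof -
    have "3 / (2 * real k) = 3 * (1 / (2 * real k))" "3 / (2 * real k + 2) = 3 * (1 / (2 * real k + 2))"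
      by simp_all
    then show ?thesis unfolding x_def atLeastLessThan_iff greaterThanAtMost_iff by linarith
  qed
  have cN: "cop_N x = N"
    unfolding cop_N_def iff using N uniq by (intro the_equality) blast+
  define L R K where "L = 1 / (2 * real N)" and "R = 1 / (2 * real N + 2)" and "K = real N * (real N + 1)"
  have cL: "cop_L x = L" and cR: "cop_R x = R" by (simp_all add: cop_L_def cop_R_def cN L_def R_def)
  have N0: "0 < real N" using N by simp
  have K0: "0 < K" using N0 by (simp add: K_def)
  have LR: "L - R = 1 / (2 * K)" using N0 by (simp add: L_def R_def K_def field_simps)
  have KL: "2 * K * L = real N + 1" and KR: "2 * K * R = real N"
    using N0 by (simp_all add: L_def R_def K_def field_simps)
  have NL: "2 * real N * L = 1" and NR: "2 * (real N + 1) * R = 1"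
    using N0 by (simp_all add: L_def R_def field_simps)
  have L0: "0 < L" and R0: "0 < R" using N0 by (simp_all add: L_def R_def)
  have d: "cop_d x = 2 * K" using K0 by (simp add: cop_d_def cL cR LR)
  have mLR: "R < m" "m \<le> L" using N(2) by (simp_all add: L_def R_def)
  have lh: "left_half x \<longleftrightarrow> (L + R) / 2 < m"
    unfolding left_half_def cL cR using mLR by (auto simp: x_def)
  have Vm: "V_min m = 2 / 3 * K * v ^ 3 - (K * v\<^sup>2)\<^sup>2"
    if "K * v\<^sup>2 = (if (L + R) / 2 < m then L - m else m - R)" "0 \<le> v" for v
  proof -
    have T: "(THE N::nat. 1 \<le> N \<and> m \<in> {1 / (2 * real N + 2) <.. 1 / (2 * real N)}) = N"
      using N uniq by (intro the_equality) blast+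
    have "arg_min_on (\<lambda>l. \<bar>m - l\<bar>) {R, L} \<in> {R, L}"
      by (rule arg_min_if_finite(1)) auto
    moreover have "\<not> (\<exists>l\<in>{R, L}. \<bar>m - l\<bar> < \<bar>m - arg_min_on (\<lambda>l. \<bar>m - l\<bar>) {R, L}\<bar>)"
      by (rule arg_min_if_finite(2)) auto
    ultimately have "\<bar>m - arg_min_on (\<lambda>l. \<bar>m - l\<bar>) {R, L}\<bar> = (if (L + R) / 2 < m then L - m else m - R)"
      using mLR by (auto split: if_splits)
    then have "\<bar>m - arg_min_on (\<lambda>l. \<bar>m - l\<bar>) {R, L}\<bar> = K * v\<^sup>2" using that by simp
    then show ?thesis
      unfolding V_min_def T Let_def L_def[symmetric] R_def[symmetric] K_def[symmetric]
      using m powr_three_halves_square[OF K0 that(2)] by simp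
  qed
  define \<Delta> where "\<Delta> = (if (L + R) / 2 < m then L - m else m - R)"
  define v where "v = sqrt (2 * \<Delta> / (2 * K))"
  have "\<Delta> \<le> (L - R) / 2" using mLR by (auto simp: \<Delta>_def)
  then have \<Delta>: "0 \<le> \<Delta>" "\<Delta> \<le> 1 / (4 * K)"
    using mLR by (auto simp: \<Delta>_def LR)
  have v0: "0 \<le> v" and Kv: "K * v\<^sup>2 = \<Delta>" using \<Delta> K0 by (simp_all add: v_def)
  have "(2 * K * v)\<^sup>2 = 4 * K * (K * v\<^sup>2)" by (simp add: power2_eq_square)
  also have "\<dots> \<le> 1\<^sup>2" using \<Delta> K0 by (simp add: Kv field_simps)
  finally have Kv1: "2 * K * v \<le> 1" by (rule power2_le_imp_le) simp
  have cv: "cop_v x = v"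
    unfolding cop_v_def Let_def mx lh cL cR d v_def \<Delta>_def by (simp del: right_diff_distrib_numeral)
  have cp: "cop_p x = 1 - 2 * K * v" by (simp add: cop_p_def d cv)
  show thesis
  proof (cases "(L + R) / 2 < m")
    case True
    define \<kappa> w where "\<kappa> = L - v / 2" and "w = (1 - 2 * K * v) * L"
    have "w = L - (2 * K * L) * v" by (simp add: w_def algebra_simps)
    then have w: "w = L - (real N + 1) * v" unfolding KL .
    have w0: "0 \<le> w" using Kv1 L0 by (simp add: w_def)
    have mv: "m = L - K * v\<^sup>2" using Kv True by (simp add: \<Delta>_def)
    have "0 < \<kappa>"
    proof (cases "v = 0")
      case False
      then have "0 < (real N + 1) * v" "v / 2 < v" using v0 N0 by auto
      moreover have "v \<le> (real N + 1) * v" using v0 N0 by (simp add: distrib_right)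
      ultimately show ?thesis using w w0 unfolding \<kappa>_def by linarith
    qed (simp add: \<kappa>_def L0)
    then have geo: "chain_geometry N v \<kappa> w N (real N * v) L 0"
      using N v0 w0 NL w by (auto simp: chain_geometry_def \<kappa>_def field_simps)
    have lhx: "left_half x" using True lh by blast
    have "cop_theta x = 2 * \<kappa>" by (simp add: cop_theta_def lhx cL cv \<kappa>_def)
    then have law: "chain_law (cop_pi x) N v \<kappa> w N (real N * v) L 0"
      using lhx by (intro chain_law_cop_pi cN N cv) (auto simp: cL cp \<kappa>_def w_def)
    have lo: "\<kappa> + v / 2 = L" and hi: "\<kappa> - v / 2 = L - v" by (simp_all add: \<kappa>_def)
    have "chain_moment N v \<kappa> w N L 1 = 2 * real N * L * w + (2 * K * L) * v - K * v\<^sup>2"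
      unfolding chain_moment_def lo hi K_def[symmetric] by (simp add: power2_eq_square field_simps)
    also have "\<dots> = m" unfolding KL NL mv w by (simp add: algebra_simps)
    finally have m1: "chain_moment N v \<kappa> w N L 1 = m" .
    have "chain_moment N v \<kappa> w N L 2 = (2 * real N * L) * w * L + (2 * K * L) * L * v - 2 * K * L * v\<^sup>2 + 2 / 3 * K * v ^ 3"
      unfolding chain_moment_def lo hi K_def[symmetric]
      by (simp add: power2_eq_square power3_eq_cube numeral_eq_Suc field_simps)
    also have "\<dots> = L\<^sup>2 - 2 * K * L * v\<^sup>2 + 2 / 3 * K * v ^ 3"
      unfolding KL NL w by (simp add: power2_eq_square algebra_simps)
    also have "\<dots> - m\<^sup>2 = V_min m"
      using Vm[of v] Kv v0 unfolding \<Delta>_def by (simp add: mv power2_eq_square field_simps)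
    finally show thesis using that[OF geo] law m1 by (simp add: x_def)
  next
    case False
    define \<kappa> w where "\<kappa> = R + v / 2" and "w = (1 - 2 * K * v) * R"
    have "w = R - (2 * K * R) * v" by (simp add: w_def algebra_simps)
    then have w: "w = R - real N * v" unfolding KR .
    have w0: "0 \<le> w" using Kv1 R0 by (simp add: w_def)
    have mv: "m = R + K * v\<^sup>2" using Kv False by (simp add: \<Delta>_def)
    have geo: "chain_geometry N v \<kappa> w (N + 1) 0 R w"
      using N v0 w0 NR w R0 by (auto simp: chain_geometry_def \<kappa>_def field_simps add_pos_nonneg)
    have lhx: "\<not> left_half x" using False lh by blast
    have "cop_theta x = 2 * \<kappa>" by (simp add: cop_theta_def lhx cR cv \<kappa>_def)
    then have law: "chain_law (cop_pi x) N v \<kappa> w (N + 1) 0 R w"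
      using lhx by (intro chain_law_cop_pi cN N cv) (auto simp: cR cp \<kappa>_def w_def)
    have lo: "\<kappa> + v / 2 = R + v" and hi: "\<kappa> - v / 2 = R" by (simp_all add: \<kappa>_def)
    have "chain_moment N v \<kappa> w (N + 1) R 1 = 2 * (real N + 1) * R * w + (2 * K * R) * v + K * v\<^sup>2"
      unfolding chain_moment_def lo hi K_def[symmetric] by (simp add: power2_eq_square field_simps)
    also have "\<dots> = m" unfolding KR NR mv w by (simp add: algebra_simps)
    finally have m1: "chain_moment N v \<kappa> w (N + 1) R 1 = m" .
    have "chain_moment N v \<kappa> w (N + 1) R 2 = (2 * (real N + 1) * R) * w * R + (2 * K * R) * R * v + 2 * K * R * v\<^sup>2 + 2 / 3 * K * v ^ 3"
      unfolding chain_moment_def lo hi K_def[symmetric]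
      by (simp add: power2_eq_square power3_eq_cube numeral_eq_Suc field_simps)
    also have "\<dots> = R\<^sup>2 + 2 * K * R * v\<^sup>2 + 2 / 3 * K * v ^ 3"
      unfolding KR NR w by (simp add: power2_eq_square algebra_simps)
    also have "\<dots> - m\<^sup>2 = V_min m"
      using Vm[of v] Kv v0 unfolding \<Delta>_def by (simp add: mv power2_eq_square field_simps)
    finally show thesis using that[OF geo] law m1 by (simp add: x_def)
  qed
qed

lemma min_copula_one:
  assumes "u \<in> {0..1}" "v \<in> {0..1}"
  shows "min_copula 1 u v = measure (reflection_law 0) ({0..u} \<times> {0..v})"
proof -
  have "min u (min 0 (1 - u)) = 0" "min v (min 0 (1 - v)) = 0"
    using assms by auto
  then show ?thesis
    using assms measure_reflection_law_box[of 0 u v] by (simp add: min_copula_def)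
qed

text \<open>
  For \<open>m = 0\<close> the minimising copula is the comonotone one.  It is not a chain law, but it is the law of the
  outer reflection with empty outer intervals.
\<close>

lemma min_copula_attains:
  assumes m: "m \<in> {0..1/2}"
  shows "copula (min_copula (1 - 3 * m))"
    and "prob_space M \<Longrightarrow> has_joint_df M U V (min_copula (1 - 3 * m)) \<Longrightarrow>
      prob_space.expectation M (\<lambda>\<omega>. \<bar>U \<omega> - V \<omega>\<bar>) = m"
    and "prob_space M \<Longrightarrow> has_joint_df M U V (min_copula (1 - 3 * m)) \<Longrightarrow>
      prob_space.variance M (\<lambda>\<omega>. \<bar>U \<omega> - V \<omega>\<bar>) = V_min m"
proof -
  obtain P where P: "sets P = sets borel" "uniform01 P fst" "uniform01 P snd"
    and C: "\<And>u v. u \<in> {0..1} \<Longrightarrow> v \<in> {0..1} \<Longrightarrow> min_copula (1 - 3 * m) u v = measure P ({0..u} \<times> {0..v})"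
    and e1: "(\<integral>z. \<bar>fst z - snd z\<bar> \<partial>P) = m"
    and e2: "(\<integral>z. \<bar>fst z - snd z\<bar>\<^sup>2 \<partial>P) = V_min m + m\<^sup>2"
  proof (cases "m = 0")
    case True
    show thesis
    proof (rule that[OF sets_reflection_law fst_reflection_law snd_reflection_law[of 0]])
      show "(\<integral>z. \<bar>fst z - snd z\<bar> \<partial>reflection_law 0) = m"
        using reflection_law_distance_moment[of 0 1] True by simp
      show "(\<integral>z. \<bar>fst z - snd z\<bar>\<^sup>2 \<partial>reflection_law 0) = V_min m + m\<^sup>2"
        using reflection_law_distance_moment[of 0 2] True by (simp add: V_min_def)
    qed (use True min_copula_one in auto)
  next
    case False
    then have "m \<in> {0<..1/2}" using m by auto
    from min_copula_is_chain[OF this] obtain N v \<kappa> w n a \<rho> b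
      where geo: "chain_geometry N v \<kappa> w n a \<rho> b"
        and law: "chain_law (cop_pi (1 - 3 * m)) N v \<kappa> w n a \<rho> b"
        and mom: "chain_moment N v \<kappa> w n \<rho> 1 = m" "chain_moment N v \<kappa> w n \<rho> 2 - m\<^sup>2 = V_min m" .
    show thesis
    proof (rule that[OF _ chain_law_uniform[OF geo law]])
      show "(\<integral>z. \<bar>fst z - snd z\<bar> \<partial>cop_pi (1 - 3 * m)) = m"
        using chain_law_moment[OF geo law, of 1] mom by simp
      show "(\<integral>z. \<bar>fst z - snd z\<bar>\<^sup>2 \<partial>cop_pi (1 - 3 * m)) = V_min m + m\<^sup>2"
        using chain_law_moment[OF geo law, of 2] mom by (simp del: power2_abs)
    qed (use False law in \<open>auto simp: min_copula_def chain_law_def\<close>)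
  qed
  have pP: "prob_space P" by (rule prob_space_uniform01[OF P(2)])
  show "copula (min_copula (1 - 3 * m))"
    unfolding copula_def using pP P C by (intro exI[of _ P]) auto
  assume M: "prob_space M" "has_joint_df M U V (min_copula (1 - 3 * m))"
  note mom = joint_df_moments[OF pP P C e1 e2 M]
  show "prob_space.expectation M (\<lambda>\<omega>. \<bar>U \<omega> - V \<omega>\<bar>) = m" by (rule mom(1))
  show "prob_space.variance M (\<lambda>\<omega>. \<bar>U \<omega> - V \<omega>\<bar>) = V_min m" using mom(2) by simp
qed

lemma V_min_le_variance:
  assumes U: "uniform01 M U" and V: "uniform01 M V"
    and m: "m = prob_space.expectation M (\<lambda>\<omega>. \<bar>U \<omega> - V \<omega>\<bar>)"
  shows "V_min m \<le> prob_space.variance M (\<lambda>\<omega>. \<bar>U \<omega> - V \<omega>\<bar>)"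
proof (cases "m = 0")
  case True
  then show ?thesis by (simp add: V_min_def)
next
  case False
  interpret prob_space M by (rule prob_space_uniform01[OF U])
  have "0 \<le> m" unfolding m by (intro Bochner_Integration.integral_nonneg) auto
  then have "m \<in> {0<..1/2}" using False distance_second_moment_le(1)[OF U V m] by auto
  from min_copula_is_chain[OF this] obtain N v \<kappa> w n a \<rho> b
    where "chain_geometry N v \<kappa> w n a \<rho> b" "chain_law (cop_pi (1 - 3 * m)) N v \<kappa> w n a \<rho> b"
      and mom: "chain_moment N v \<kappa> w n \<rho> 1 = m" "chain_moment N v \<kappa> w n \<rho> 2 - m\<^sup>2 = V_min m" .
  then have "chain_moment N v \<kappa> w n \<rho> 2 \<le> (\<integral>\<omega>. \<bar>U \<omega> - V \<omega>\<bar>\<^sup>2 \<partial>M)"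
    using m by (intro chain_law_minimal_second_moment[OF _ _ U V]) auto
  then show ?thesis
    unfolding variance_distance[OF U V] using mom(2) m by simp
qed

theorem corollary1p7:
  shows
    "(\<forall>(M :: 'a measure) U V m.
        prob_space M \<and> uniform01 M U \<and> uniform01 M V \<and>
        m = prob_space.expectation M (\<lambda>\<omega>. \<bar>U \<omega> - V \<omega>\<bar>) \<longrightarrow>
          V_min m \<le> prob_space.variance M (\<lambda>\<omega>. \<bar>U \<omega> - V \<omega>\<bar>) \<and>
          prob_space.variance M (\<lambda>\<omega>. \<bar>U \<omega> - V \<omega>\<bar>) \<le> V_max m) \<and>
     (\<forall>m\<in>{0..1/2}.
        copula (min_copula (1 - 3 * m)) \<and>
        (\<forall>(M :: 'a measure) U V.
           prob_space M \<and> has_joint_df M U V (min_copula (1 - 3 * m)) \<longrightarrow>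
             prob_space.expectation M (\<lambda>\<omega>. \<bar>U \<omega> - V \<omega>\<bar>) = m \<and>
             prob_space.variance M (\<lambda>\<omega>. \<bar>U \<omega> - V \<omega>\<bar>) = V_min m)) \<and>
     (\<forall>m\<in>{0..1/2}.
        copula (bertino_copula (1 - 3 * m)) \<and>
        (\<forall>(M :: 'a measure) U V.
           prob_space M \<and> has_joint_df M U V (bertino_copula (1 - 3 * m)) \<longrightarrow>
             prob_space.expectation M (\<lambda>\<omega>. \<bar>U \<omega> - V \<omega>\<bar>) = m \<and>
             prob_space.variance M (\<lambda>\<omega>. \<bar>U \<omega> - V \<omega>\<bar>) = V_max m))"
proof (intro conjI allI ballI impI; (elim conjE)?)
  fix M :: "'a measure" and U V m
  assume U: "uniform01 M U" and V: "uniform01 M V"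
    and m: "m = prob_space.expectation M (\<lambda>\<omega>. \<bar>U \<omega> - V \<omega>\<bar>)"
  show "V_min m \<le> prob_space.variance M (\<lambda>\<omega>. \<bar>U \<omega> - V \<omega>\<bar>)"
    by (rule V_min_le_variance[OF U V m])
  show "prob_space.variance M (\<lambda>\<omega>. \<bar>U \<omega> - V \<omega>\<bar>) \<le> V_max m"
    using distance_second_moment_le(2)[OF U V m] m
    by (simp add: variance_distance[OF U V] V_max_def)
next
  fix m :: real assume m: "m \<in> {0..1/2}"
  show "copula (min_copula (1 - 3 * m))" by (rule min_copula_attains(1)[OF m])
  show "copula (bertino_copula (1 - 3 * m))" by (rule bertino_attains(1)[OF m])
  fix M :: "'a measure" and U V
  assume M: "prob_space M"
  show "prob_space.expectation M (\<lambda>\<omega>. \<bar>U \<omega> - V \<omega>\<bar>) = m"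
    "prob_space.variance M (\<lambda>\<omega>. \<bar>U \<omega> - V \<omega>\<bar>) = V_min m"
    if "has_joint_df M U V (min_copula (1 - 3 * m))"
    using min_copula_attains(2,3)[OF m M that] by simp_all
  show "prob_space.expectation M (\<lambda>\<omega>. \<bar>U \<omega> - V \<omega>\<bar>) = m"
    "prob_space.variance M (\<lambda>\<omega>. \<bar>U \<omega> - V \<omega>\<bar>) = V_max m"
    if "has_joint_df M U V (bertino_copula (1 - 3 * m))"
    using bertino_attains(2,3)[OF m M that] by simp_all
qed

end
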